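(* (MSL(SDC) Decidability.) Satisfiability of the MSL(SDC) first-order fragment is decidable: there is an algorithm that, given a finite set $N$ of MSL(SDC) clauses, decides whether $N$ is satisfiable.
   Context: Clauses are written $\Gamma\rightarrow\Delta$ where $\Gamma$ (antecedent, negative literals) and $\Delta$ (succedent, positive literals) are finite multisets of atoms. Depth of variables and constants is $0$, depth$(f(s_1,\dots,s_n))=1+\max_i$ depth$(s_i)$; a term is shallow if its depth is at most 1 and linear if no variable occurs twice in it. A variable and a constant are straight; $f(s_1,\dots,s_n)$ is straight if $s_1,\dots,s_n$ are pairwise distinct variables except for at most one argument that is a straight term. A straight dismatching constraint (SDC) is a finite conjunction $\pi=\bigwedge_i t_i\neq s_i$ of disequations with $t_i,s_i$ variable-disjoint terms and $s_i$ straight. A solution of $\pi$ is a grounding substitution $\delta$ such that for no $i$ is $t_i\delta$ an instance of $s_i$. An MSL clause is a clause $\Gamma\rightarrow\Delta$ such that (i) every argument term of an atom in $\Delta$ is shallow, every atom in $\Delta$ is linear, and distinct atoms in $\Delta$ share no variables; (ii) all predicates occurring are monadic; (iii) no equations occur in $\Delta$; (iv) no equations occur in $\Gamma$, or $\Gamma=\{s\approx t\}$, $\Delta$ is empty and $s,t$ are not unifiable. An MSL(SDC) clause is a pair $(C;\pi)$ of an MSL clause $C$ and an SDC $\pi$; its ground instances are the clauses $C\delta$ with $\delta$ a solution of $\pi$ grounding all variables of $C$ and of the $t_i$. A Herbrand interpretation $I$ is a set of ground atoms; it satisfies a ground clause $\Gamma\rightarrow\Delta$ if $\Delta\cap I\neq\emptyset$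 or $\Gamma\not\subseteq I$, satisfies $(C;\pi)$ if it satisfies all its ground instances, and a set of constrained clauses is satisfiable if some Herbrand interpretation satisfies all its members. *)

theory Defs
  imports Main "HOL-Library.Nat_Bijection"
begin

datatype recf = Zero | Succ | Proj nat | Comp recf "recf list" | Prec recf recf | Mini recf

inductive eval_recf :: "recf \<Rightarrow> nat list \<Rightarrow> nat \<Rightarrow> bool" where
  zero: "eval_recf Zero xs 0"
| succ: "eval_recf Succ (x # xs) (Suc x)"
| proj: "i < length xs \<Longrightarrow> eval_recf (Proj i) xs (xs ! i)"
| comp: "list_all2 (\<lambda>g y. eval_recf g xs y) gs ys \<Longrightarrow> eval_recf f ys z \<Longrightarrow> eval_recf (Comp f gs) xs z"
| prec0: "eval_recf g xs y \<Longrightarrow> eval_recf (Prec g h) (0 # xs) y"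
| precS: "eval_recf (Prec g h) (n # xs) y \<Longrightarrow> eval_recf h (y # n # xs) z
          \<Longrightarrow> eval_recf (Prec g h) (Suc n # xs) z"
| mini: "eval_recf f (y # xs) 0 \<Longrightarrow> (\<forall>k<y. \<exists>m. 0 < m \<and> eval_recf f (k # xs) m)
          \<Longrightarrow> eval_recf (Mini f) xs y"

definition decidable_on :: "('a \<Rightarrow> nat) \<Rightarrow> ('a \<Rightarrow> bool) \<Rightarrow> ('a \<Rightarrow> bool) \<Rightarrow> bool" where
  "decidable_on enc valid P \<longleftrightarrow>
     (\<exists>f. \<forall>x. valid x \<longrightarrow> eval_recf f [enc x] (if P x then 1 else 0))"

datatype trm = V nat | F nat "trm list"

datatype atom = P nat trm | Eq trm trm

fun vars :: "trm \<Rightarrow> nat set" where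
  "vars (V x) = {x}"
| "vars (F f ts) = (\<Union>t\<in>set ts. vars t)"

fun var_occs :: "trm \<Rightarrow> nat list" where
  "var_occs (V x) = [x]"
| "var_occs (F f ts) = concat (map var_occs ts)"

fun depth :: "trm \<Rightarrow> nat" where
  "depth (V x) = 0"
| "depth (F f ts) = (if ts = [] then 0 else Suc (Max (set (map depth ts))))"

definition shallow :: "trm \<Rightarrow> bool" where
  "shallow t \<longleftrightarrow> depth t \<le> 1"

definition linear :: "trm \<Rightarrow> bool" where
  "linear t \<longleftrightarrow> distinct (var_occs t)"

fun is_var :: "trm \<Rightarrow> bool" where
  "is_var (V x) = True"
| "is_var (F f ts) = False"

fun straight :: "trm \<Rightarrow> bool" where
  "straight (V x) = True"
| "straight (F f ts) =
     (distinct (concat (map var_occs ts)) \<and>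
      length (filter (\<lambda>t. \<not> is_var t) ts) \<le> 1 \<and> list_all straight ts)"

fun subst :: "trm \<Rightarrow> (nat \<Rightarrow> trm) \<Rightarrow> trm" where
  "subst (V x) \<sigma> = \<sigma> x"
| "subst (F f ts) \<sigma> = F f (map (\<lambda>t. subst t \<sigma>) ts)"

definition instance_of :: "trm \<Rightarrow> trm \<Rightarrow> bool" where
  "instance_of t s \<longleftrightarrow> (\<exists>\<sigma>. subst s \<sigma> = t)"

definition unifiable :: "trm \<Rightarrow> trm \<Rightarrow> bool" where
  "unifiable s t \<longleftrightarrow> (\<exists>\<sigma>. subst s \<sigma> = subst t \<sigma>)"

fun atom_vars :: "atom \<Rightarrow> nat set" where
  "atom_vars (P p t) = vars t"
| "atom_vars (Eq s t) = vars s \<union> vars t"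

fun atom_subst :: "atom \<Rightarrow> (nat \<Rightarrow> trm) \<Rightarrow> atom" where
  "atom_subst (P p t) \<sigma> = P p (subst t \<sigma>)"
| "atom_subst (Eq s t) \<sigma> = Eq (subst s \<sigma>) (subst t \<sigma>)"

fun is_pred_atom :: "atom \<Rightarrow> bool" where
  "is_pred_atom (P p t) = True"
| "is_pred_atom (Eq s t) = False"

text \<open>A clause \<Gamma> \<rightarrow> \<Delta>; the finite multisets \<Gamma>, \<Delta> are represented by lists.\<close>
type_synonym clause = "atom list \<times> atom list"

text \<open>A straight dismatching constraint: list of disequations t \<noteq> s.\<close>
type_synonym sdc = "(trm \<times> trm) list"

type_synonym cclause = "clause \<times> sdc"

text \<open>Signature: finite list of function symbols paired with their arities.\<close>
type_synonym signature = "(nat \<times> nat) list"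

fun wf_term :: "signature \<Rightarrow> trm \<Rightarrow> bool" where
  "wf_term \<Sigma> (V x) = True"
| "wf_term \<Sigma> (F f ts) = ((f, length ts) \<in> set \<Sigma> \<and> list_all (wf_term \<Sigma>) ts)"

definition ground_term :: "signature \<Rightarrow> trm \<Rightarrow> bool" where
  "ground_term \<Sigma> t \<longleftrightarrow> wf_term \<Sigma> t \<and> vars t = {}"

fun wf_atom :: "signature \<Rightarrow> atom \<Rightarrow> bool" where
  "wf_atom \<Sigma> (P p t) = wf_term \<Sigma> t"
| "wf_atom \<Sigma> (Eq s t) = (wf_term \<Sigma> s \<and> wf_term \<Sigma> t)"

definition is_sdc :: "sdc \<Rightarrow> bool" where
  "is_sdc \<pi> \<longleftrightarrow> (\<forall>(t, s)\<in>set \<pi>. vars t \<inter> vars s = {} \<and> straight s)"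

definition msl_clause :: "clause \<Rightarrow> bool" where
  "msl_clause C \<longleftrightarrow>
     (let (\<Gamma>, \<Delta>) = C in
       \<comment> \<open>(i) and (iii); (ii) holds by construction of the atom type\<close>
       (\<forall>A\<in>set \<Delta>. \<exists>p t. A = P p t \<and> shallow t \<and> linear t) \<and>
       (\<forall>A\<in>set \<Delta>. \<forall>B\<in>set \<Delta>. A \<noteq> B \<longrightarrow> atom_vars A \<inter> atom_vars B = {}) \<and>
       \<comment> \<open>(iv)\<close>
       ((\<forall>A\<in>set \<Gamma>. is_pred_atom A) \<or>
        (\<exists>s t. \<Gamma> = [Eq s t] \<and> \<Delta> = [] \<and> \<not> unifiable s t)))"

definition wf_cclause :: "signature \<Rightarrow> cclause \<Rightarrow> bool" where
  "wf_cclause \<Sigma> cc \<longleftrightarrow>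
     (let ((\<Gamma>, \<Delta>), \<pi>) = cc in
       list_all (wf_atom \<Sigma>) (\<Gamma> @ \<Delta>) \<and>
       (\<forall>(t, s)\<in>set \<pi>. wf_term \<Sigma> t \<and> wf_term \<Sigma> s))"

definition msl_sdc_clause :: "signature \<Rightarrow> cclause \<Rightarrow> bool" where
  "msl_sdc_clause \<Sigma> cc \<longleftrightarrow> msl_clause (fst cc) \<and> is_sdc (snd cc) \<and> wf_cclause \<Sigma> cc"

definition cclause_vars :: "cclause \<Rightarrow> nat set" where
  "cclause_vars cc =
     (let ((\<Gamma>, \<Delta>), \<pi>) = cc in
        (\<Union>A\<in>set (\<Gamma> @ \<Delta>). atom_vars A) \<union> (\<Union>(t, s)\<in>set \<pi>. vars t))"

definition sdc_solution :: "sdc \<Rightarrow> (nat \<Rightarrow> trm) \<Rightarrow> bool" where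
  "sdc_solution \<pi> \<delta> \<longleftrightarrow> (\<forall>(t, s)\<in>set \<pi>. \<not> instance_of (subst t \<delta>) s)"

definition ground_instance_subst :: "signature \<Rightarrow> cclause \<Rightarrow> (nat \<Rightarrow> trm) \<Rightarrow> bool" where
  "ground_instance_subst \<Sigma> cc \<delta> \<longleftrightarrow>
     (\<forall>x\<in>cclause_vars cc. ground_term \<Sigma> (\<delta> x)) \<and> sdc_solution (snd cc) \<delta>"

definition clause_subst :: "clause \<Rightarrow> (nat \<Rightarrow> trm) \<Rightarrow> clause" where
  "clause_subst C \<delta> = (map (\<lambda>A. atom_subst A \<delta>) (fst C), map (\<lambda>A. atom_subst A \<delta>) (snd C))"

definition sat_ground :: "atom set \<Rightarrow> clause \<Rightarrow> bool" where
  "sat_ground I C \<longleftrightarrow> set (snd C) \<inter> I \<noteq> {} \<or> \<not> set (fst C) \<subseteq> I"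

definition sat_cclause :: "signature \<Rightarrow> atom set \<Rightarrow> cclause \<Rightarrow> bool" where
  "sat_cclause \<Sigma> I cc \<longleftrightarrow>
     (\<forall>\<delta>. ground_instance_subst \<Sigma> cc \<delta> \<longrightarrow> sat_ground I (clause_subst (fst cc) \<delta>))"

definition satisfiable :: "signature \<Rightarrow> cclause list \<Rightarrow> bool" where
  "satisfiable \<Sigma> N \<longleftrightarrow> (\<exists>I. \<forall>cc\<in>set N. sat_cclause \<Sigma> I cc)"

fun enc_trm :: "trm \<Rightarrow> nat" where
  "enc_trm (V x) = prod_encode (0, x)"
| "enc_trm (F f ts) = prod_encode (1, prod_encode (f, list_encode (map enc_trm ts)))"

fun enc_atom :: "atom \<Rightarrow> nat" where
  "enc_atom (P p t) = prod_encode (0, prod_encode (p, enc_trm t))"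
| "enc_atom (Eq s t) = prod_encode (1, prod_encode (enc_trm s, enc_trm t))"

definition enc_cclause :: "cclause \<Rightarrow> nat" where
  "enc_cclause cc =
     (let ((\<Gamma>, \<Delta>), \<pi>) = cc in
        prod_encode (prod_encode (list_encode (map enc_atom \<Gamma>), list_encode (map enc_atom \<Delta>)),
                     list_encode (map (\<lambda>(t, s). prod_encode (enc_trm t, enc_trm s)) \<pi>)))"

definition enc_input :: "signature \<times> cclause list \<Rightarrow> nat" where
  "enc_input inp =
     prod_encode (list_encode (map prod_encode (fst inp)), list_encode (map enc_cclause (snd inp)))"

definition msl_sdc_input :: "signature \<times> cclause list \<Rightarrow> bool" where
  "msl_sdc_input inp \<longleftrightarrow> (\<forall>cc\<in>set (snd inp). msl_sdc_clause (fst inp) cc)"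

end

(*
  Given a model I of the clauses, let P(f(t1,..,tn)) be true in I' iff P(f(u1,..,un)) is true in I
  for every choice of ground terms ui that satisfy in I all predicates true of ti in I' and match
  the same right-hand sides of disequations (up to a bound on codes).  Since succedent atoms are
  shallow, linear and variable-disjoint, I' is again a model, and by construction the predicates and
  patterns of f(t1,..,tn) in I' depend only on f and those of the arguments.  As finitely many
  combinations of predicates and patterns occur, satisfiability is equivalent to the existence of a
  finite algebra on such combinations, of computably bounded size, in which no clause is falsified
  by a valuation of its subterms.  Coding finite sets as bit sets, this is a formula with bounded
  quantifiers only, hence decided by a primitive recursive function.
*)
theory Submission
  imports Defs
begin

text \<open>The obstacle is that in a model \<open>I\<close> the predicates true of a compound term
  need not be determined by finite information on its arguments, so \<open>I\<close> has no evident
  finite quotient. Intersecting over all arguments of the same class restores this dependence but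
  removes atoms, and a clause might become false because its succedent was removed. A removed atom
  is refuted in \<open>I\<close> at other arguments, and the syntactic restrictions serve to make
  these refutations simultaneous: shallowness and linearity realise each of them by a substitution,
  disjointness merges the substitutions into one. Such a replacement keeps antecedents true and
  patterns unchanged below function symbols of any depth, so the counterexample moves back to
  \<open>I\<close>. Equations are never true in the new interpretation, which disposes of
  antecedents that are equations. On the side of computability, evaluating coded terms would need
  recursion over their codes. Quantifying over a table of values for subterms replaces it:
  correctness of a table is a local condition.\<close>

section \<open>Recursive functions of fixed arity\<close>

definition cf :: "nat \<Rightarrow> (nat list \<Rightarrow> nat) \<Rightarrow> bool" where
  "cf k f \<longleftrightarrow> (\<exists>r. \<forall>xs. length xs = k \<longrightarrow> eval_recf r xs (f xs))"

lemma cf_nth: "i < k \<Longrightarrow> cf k (\<lambda>xs. xs ! i)"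
  unfolding cf_def using eval_recf.proj by blast

lemma cf_Suc:
  assumes "cf k g" shows "cf k (\<lambda>xs. Suc (g xs))"
proof -
  obtain r where "\<And>xs. length xs = k \<Longrightarrow> eval_recf r xs (g xs)"
    using assms unfolding cf_def by blast
  then have "eval_recf (Comp Succ [r]) xs (Suc (g xs))" if "length xs = k" for xs
    using that by (intro eval_recf.comp[where ys = "[g xs]"] eval_recf.succ) auto
  then show ?thesis unfolding cf_def by blast
qed

lemma cf_const: "cf k (\<lambda>_. c)"
proof (induction c)
  case 0 show ?case unfolding cf_def using eval_recf.zero by blast
next
  case (Suc c) then show ?case by (rule cf_Suc)
qed

lemma cf_comp1:
  assumes "cf 1 (\<lambda>xs. f (xs ! 0))" and "cf k g"
  shows "cf k (\<lambda>xs. f (g xs))"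
proof -
  obtain r where r: "\<And>xs. length xs = 1 \<Longrightarrow> eval_recf r xs (f (xs ! 0))"
    using assms(1) unfolding cf_def by blast
  obtain s where s: "\<And>xs. length xs = k \<Longrightarrow> eval_recf s xs (g xs)"
    using assms(2) unfolding cf_def by blast
  have "eval_recf (Comp r [s]) xs (f (g xs))" if "length xs = k" for xs
    using r[of "[g xs]"] s[OF that] by (intro eval_recf.comp[where ys = "[g xs]"]) auto
  then show ?thesis unfolding cf_def by blast
qed

lemma cf_comp2:
  assumes "cf 2 (\<lambda>xs. f (xs ! 0) (xs ! 1))" and "cf k g" and "cf k h"
  shows "cf k (\<lambda>xs. f (g xs) (h xs))"
proof -
  obtain r where r: "\<And>xs. length xs = 2 \<Longrightarrow> eval_recf r xs (f (xs ! 0) (xs ! 1))"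
    using assms(1) unfolding cf_def by blast
  obtain s where s: "\<And>xs. length xs = k \<Longrightarrow> eval_recf s xs (g xs)"
    using assms(2) unfolding cf_def by blast
  obtain t where t: "\<And>xs. length xs = k \<Longrightarrow> eval_recf t xs (h xs)"
    using assms(3) unfolding cf_def by blast
  have "eval_recf (Comp r [s, t]) xs (f (g xs) (h xs))" if "length xs = k" for xs
    using r[of "[g xs, h xs]"] s[OF that] t[OF that]
    by (intro eval_recf.comp[where ys = "[g xs, h xs]"]) auto
  then show ?thesis unfolding cf_def by blast
qed

lemma cf_rec:
  assumes g: "cf k g" and h: "cf (Suc (Suc k)) h"
    and f0: "\<And>xs. length xs = k \<Longrightarrow> f (0 # xs) = g xs"
    and fS: "\<And>n xs. length xs = k \<Longrightarrow> f (Suc n # xs) = h (f (n # xs) # n # xs)"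
  shows "cf (Suc k) f"
proof -
  obtain r where r: "\<And>xs. length xs = k \<Longrightarrow> eval_recf r xs (g xs)"
    using g unfolding cf_def by blast
  obtain s where s: "\<And>xs. length xs = Suc (Suc k) \<Longrightarrow> eval_recf s xs (h xs)"
    using h unfolding cf_def by blast
  have "eval_recf (Prec r s) (n # xs) (f (n # xs))" if "length xs = k" for n xs
  proof (induction n)
    case 0 show ?case using r[OF that] f0[OF that] by (simp add: eval_recf.prec0)
  next
    case (Suc n)
    then show ?case using s[of "f (n # xs) # n # xs"] fS[OF that, of n] that
      by (auto intro: eval_recf.precS)
  qed
  then have "eval_recf (Prec r s) xs (f xs)" if "length xs = Suc k" for xs
    using that by (cases xs) auto
  then show ?thesis unfolding cf_def by blast
qed

lemma cf_rec1:
  assumes "cf 2 (\<lambda>xs. h (xs ! 0) (xs ! 1))"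
    and "\<And>n. f (Suc n) = h (f n) n"
  shows "cf 1 (\<lambda>xs. f (xs ! 0))"
  using cf_rec[OF cf_const[of 0 "f 0"], of "\<lambda>xs. h (xs ! 0) (xs ! 1)" "\<lambda>xs. f (xs ! 0)"] assms
  by (simp add: numeral_2_eq_2)

lemma cf_rec2:
  assumes "cf 1 (\<lambda>xs. g (xs ! 0))" and "cf 3 (\<lambda>xs. h (xs ! 0) (xs ! 1) (xs ! 2))"
    and "\<And>e. f 0 e = g e" and "\<And>n e. f (Suc n) e = h (f n e) n e"
  shows "cf 2 (\<lambda>xs. f (xs ! 0) (xs ! 1))"
  using cf_rec[of 1 "\<lambda>xs. g (xs ! 0)" "\<lambda>xs. h (xs ! 0) (xs ! 1) (xs ! 2)"
      "\<lambda>xs. f (xs ! 0) (xs ! 1)"] assms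
  by (simp add: numeral_2_eq_2 numeral_3_eq_3)

text \<open>\<open>Prec\<close> recurses on the first argument, whereas truncated subtraction
  recurses on its second one.\<close>

lemma cf_swap: "cf 2 (\<lambda>xs. f (xs ! 1) (xs ! 0)) \<Longrightarrow> cf 2 (\<lambda>xs. f (xs ! 0) (xs ! 1))"
  using cf_comp2[of "\<lambda>a b. f b a" 2 "\<lambda>xs. xs ! 1" "\<lambda>xs. xs ! 0"] by (simp add: cf_nth)

lemma cf_add: "cf 2 (\<lambda>xs. xs ! 0 + xs ! 1)"
  by (rule cf_rec2[where g = "\<lambda>e. e" and h = "\<lambda>y n e. Suc y"]) (rule cf_nth cf_Suc | simp)+

lemmas cf_plus = cf_comp2[OF cf_add]

lemma cf_mult: "cf 2 (\<lambda>xs. xs ! 0 * xs ! 1)"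
  by (rule cf_rec2[where g = "\<lambda>e. 0" and h = "\<lambda>y n e. y + e"])
    (rule cf_nth cf_const cf_plus | simp)+

lemmas cf_times = cf_comp2[OF cf_mult]

lemma cf_pred: "cf 1 (\<lambda>xs. xs ! 0 - 1)"
  by (rule cf_rec1[where h = "\<lambda>y n. n"]) (rule cf_nth | simp)+

lemma cf_monus: "cf 2 (\<lambda>xs. xs ! 0 - xs ! 1)"
  by (rule cf_swap, rule cf_rec2[where g = "\<lambda>e. e" and h = "\<lambda>y n e. y - 1"])
    (rule cf_nth cf_comp1[OF cf_pred] | simp)+

lemmas cf_minus = cf_comp2[OF cf_monus]

lemma cf_power2: "cf 1 (\<lambda>xs. 2 ^ (xs ! 0))"
  by (rule cf_rec1[where h = "\<lambda>y n. 2 * y"]) (rule cf_nth cf_const cf_times | simp)+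

lemma cf_triangle: "cf 1 (\<lambda>xs. triangle (xs ! 0))"
  by (rule cf_rec1[where h = "\<lambda>y n. y + Suc n"]) (rule cf_nth cf_Suc cf_plus | simp)+

section \<open>Inverting the Cantor pairing\<close>

definition pr :: "nat \<Rightarrow> nat \<Rightarrow> nat" where
  "pr a b = prod_encode (a, b)"

definition pfst :: "nat \<Rightarrow> nat" where
  "pfst z = fst (prod_decode z)"

definition psnd :: "nat \<Rightarrow> nat" where
  "psnd z = snd (prod_decode z)"

lemma pfst_pr [simp]: "pfst (pr a b) = a" and psnd_pr [simp]: "psnd (pr a b) = b"
  by (simp_all add: pr_def pfst_def psnd_def)

lemma pr_pfst_psnd [simp]: "pr (pfst z) (psnd z) = z"
  by (simp add: pr_def pfst_def psnd_def)

lemma pr_eq_iff: "pr a b = pr c d \<longleftrightarrow> a = c \<and> b = d"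
  by (simp add: pr_def prod_encode_eq)

lemma cf_pr: "cf 2 (\<lambda>xs. pr (xs ! 0) (xs ! 1))"
  unfolding pr_def prod_encode_def prod.case
  by (rule cf_plus cf_comp1[OF cf_triangle] cf_nth | simp)+

text \<open>This is the index of the antidiagonal on which the pair coded by \<open>z\<close> lies,
  that is, the sum of its components. The truncated difference \<open>1 - (...)\<close> is 1 exactly
  when \<open>Suc z\<close> starts the next antidiagonal.\<close>

fun diagonal :: "nat \<Rightarrow> nat" where
  "diagonal 0 = 0"
| "diagonal (Suc z) = (let k = diagonal z in k + (1 - (triangle (Suc k) - Suc z)))"

lemma cf_diagonal: "cf 1 (\<lambda>xs. diagonal (xs ! 0))"
  by (rule cf_rec1[where h = "\<lambda>k z. k + (1 - (triangle (Suc k) - Suc z))"])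
    (rule cf_plus cf_minus cf_const cf_comp1[OF cf_triangle] cf_Suc cf_nth |
      simp add: Let_def del: triangle_Suc)+

lemma diagonal_bounds: "triangle (diagonal z) \<le> z \<and> z < triangle (Suc (diagonal z))"
proof (induction z)
  case (Suc z)
  show ?case
  proof (cases "triangle (Suc (diagonal z)) \<le> Suc z")
    case True
    then have "diagonal (Suc z) = Suc (diagonal z)" by (simp add: Let_def)
    with True Suc show ?thesis by simp
  next
    case False
    then have "diagonal (Suc z) = diagonal z" by (simp add: Let_def)
    with False Suc show ?thesis by simp
  qed
qed simp

text \<open>The intervals between consecutive triangular numbers are disjoint, and
  \<open>pr a b\<close> lies in the one that starts at \<open>triangle (a + b)\<close>.\<close>

lemma diagonal_pr: "diagonal (pr a b) = a + b"
proof -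
  have mono: "triangle m \<le> triangle n" if "m \<le> n" for m n
    using that by (induction n rule: dec_induct) auto
  have *: "triangle (a + b) \<le> pr a b" "pr a b < triangle (Suc (a + b))"
    by (simp_all add: pr_def prod_encode_def)
  note ** = diagonal_bounds[of "pr a b"]
  have "\<not> Suc (diagonal (pr a b)) \<le> a + b"
    using mono[of "Suc (diagonal (pr a b))" "a + b"] * ** by linarith
  moreover have "\<not> Suc (a + b) \<le> diagonal (pr a b)"
    using mono[of "Suc (a + b)" "diagonal (pr a b)"] * ** by linarith
  ultimately show ?thesis by linarith
qed

lemma diagonal_eq: "diagonal z = pfst z + psnd z"
  using diagonal_pr[of "pfst z" "psnd z"] by simp

lemma pfst_eq: "pfst z = z - triangle (diagonal z)"
proof -
  have "triangle (pfst z + psnd z) + pfst z = z"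
    using pr_pfst_psnd[of z] unfolding pr_def prod_encode_def by simp
  then show ?thesis unfolding diagonal_eq by linarith
qed

lemma psnd_eq: "psnd z = diagonal z - (z - triangle (diagonal z))"
  using diagonal_eq[of z] pfst_eq[of z] by linarith

lemma cf_pfst: "cf 1 (\<lambda>xs. pfst (xs ! 0))"
  unfolding pfst_eq by (rule cf_minus cf_comp1[OF cf_triangle] cf_diagonal cf_nth | simp)+

lemma cf_psnd: "cf 1 (\<lambda>xs. psnd (xs ! 0))"
  unfolding psnd_eq by (rule cf_minus cf_comp1[OF cf_triangle] cf_diagonal cf_nth | simp)+

section \<open>Decidable predicates and bounded quantifiers\<close>

text \<open>Unary functions suffice because all variables in scope are packed into nested pairs. A
  bounded quantifier adds one component to the pair, so decidability of a formula follows by rules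
  that only look at its syntax.\<close>

definition computable :: "(nat \<Rightarrow> nat) \<Rightarrow> bool" where
  "computable f \<longleftrightarrow> cf 1 (\<lambda>xs. f (xs ! 0))"

named_theorems computable_intros

lemma computable_id [computable_intros]: "computable (\<lambda>z. z)"
  unfolding computable_def by (rule cf_nth) simp

lemma computable_const [computable_intros]: "computable (\<lambda>z. c)"
  unfolding computable_def by (rule cf_const)

lemma computable_Suc [computable_intros]: "computable f \<Longrightarrow> computable (\<lambda>z. Suc (f z))"
  unfolding computable_def by (rule cf_Suc)

lemma computable_plus [computable_intros]:
  "computable f \<Longrightarrow> computable g \<Longrightarrow> computable (\<lambda>z. f z + g z)"
  unfolding computable_def by (rule cf_plus)

lemma computable_times [computable_intros]:
  "computable f \<Longrightarrow> computable g \<Longrightarrow> computable (\<lambda>z. f z * g z)"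
  unfolding computable_def by (rule cf_times)

lemma computable_minus [computable_intros]:
  "computable f \<Longrightarrow> computable g \<Longrightarrow> computable (\<lambda>z. f z - g z)"
  unfolding computable_def by (rule cf_minus)

lemma computable_power2 [computable_intros]: "computable f \<Longrightarrow> computable (\<lambda>z. 2 ^ f z)"
  unfolding computable_def by (rule cf_comp1[OF cf_power2])

lemma computable_pr [computable_intros]:
  "computable f \<Longrightarrow> computable g \<Longrightarrow> computable (\<lambda>z. pr (f z) (g z))"
  unfolding computable_def by (rule cf_comp2[OF cf_pr])

lemma computable_pfst [computable_intros]: "computable f \<Longrightarrow> computable (\<lambda>z. pfst (f z))"
  unfolding computable_def by (rule cf_comp1[OF cf_pfst])

lemma computable_psnd [computable_intros]: "computable f \<Longrightarrow> computable (\<lambda>z. psnd (f z))"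
  unfolding computable_def by (rule cf_comp1[OF cf_psnd])

lemma computable_rec:
  assumes f: "\<And>e. f 0 e = g e" "\<And>n e. f (Suc n) e = h (f n e) n e"
    and g: "computable g"
    and h: "computable (\<lambda>z. h (pfst z) (pfst (psnd z)) (psnd (psnd z)))"
    and ab: "computable a" "computable b"
  shows "computable (\<lambda>z. f (a z) (b z))"
proof -
  have "cf 3 (\<lambda>xs. h (xs ! 0) (xs ! 1) (xs ! 2))"
    using cf_comp1[OF h[unfolded computable_def],
        of 3 "\<lambda>xs. pr (xs ! 0) (pr (xs ! 1) (xs ! 2))"]
    by (simp add: cf_nth cf_comp2[OF cf_pr])
  then show ?thesis using cf_comp2[OF cf_rec2[of g h f]] f g ab unfolding computable_def by simp
qed

lemma computable_comp: "computable f \<Longrightarrow> computable g \<Longrightarrow> computable (\<lambda>z. f (g z))"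
  unfolding computable_def by (rule cf_comp1)

definition decidable :: "(nat \<Rightarrow> bool) \<Rightarrow> bool" where
  "decidable Q \<longleftrightarrow> computable (\<lambda>z. of_bool (Q z))"

lemma decidable_comp: "decidable Q \<Longrightarrow> computable g \<Longrightarrow> decidable (\<lambda>z. Q (g z))"
  unfolding decidable_def by (rule computable_comp)

lemma decidable_not [computable_intros]: "decidable Q \<Longrightarrow> decidable (\<lambda>z. \<not> Q z)"
  using computable_minus[OF computable_const[of 1], of "\<lambda>z. of_bool (Q z)"] unfolding decidable_def
  by (rule back_subst[of computable]) auto

lemma decidable_conj [computable_intros]:
  "decidable Q \<Longrightarrow> decidable R \<Longrightarrow> decidable (\<lambda>z. Q z \<and> R z)"
  unfolding decidable_def of_bool_conj by (intro computable_intros)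

lemma decidable_disj [computable_intros]:
  "decidable Q \<Longrightarrow> decidable R \<Longrightarrow> decidable (\<lambda>z. Q z \<or> R z)"
  using decidable_not[OF decidable_conj[OF decidable_not decidable_not]] by simp

lemma decidable_imp [computable_intros]:
  "decidable Q \<Longrightarrow> decidable R \<Longrightarrow> decidable (\<lambda>z. Q z \<longrightarrow> R z)"
  unfolding imp_conv_disj by (intro computable_intros)

lemma decidable_le [computable_intros]:
  assumes "computable f" "computable g" shows "decidable (\<lambda>z. f z \<le> g z)"
proof -
  have "of_bool (f z \<le> g z) = 1 - (f z - g z)" for z by simp
  then show ?thesis unfolding decidable_def using assms by (auto intro: computable_intros)
qed

lemma decidable_less [computable_intros]:
  "computable f \<Longrightarrow> computable g \<Longrightarrow> decidable (\<lambda>z. f z < g z)"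
  unfolding not_le[symmetric] by (intro computable_intros)

lemma decidable_eq [computable_intros]:
  "computable f \<Longrightarrow> computable g \<Longrightarrow> decidable (\<lambda>z. f z = g z)"
  unfolding eq_iff by (intro computable_intros)

lemma decidable_Ex [computable_intros]:
  assumes "computable b" and Q: "decidable (\<lambda>z. Q (pfst z) (psnd z))"
  shows "decidable (\<lambda>z. \<exists>k<b z. Q z k)"
proof -
  define q where "q e k = (of_bool (Q e k) :: nat)" for e k
  define f where "f n e = (of_bool (\<exists>k<n. Q e k) :: nat)" for n e
  have q: "computable (\<lambda>z. q (pfst z) (psnd z))"
    using Q unfolding decidable_def q_def .
  have q': "computable (\<lambda>z. q (g z) (h z))" if "computable g" "computable h" for g h
    using cf_comp1[OF q[unfolded computable_def], of 1 "\<lambda>xs. pr (g (xs ! 0)) (h (xs ! 0))"]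
      that cf_comp2[OF cf_pr] unfolding computable_def by simp
  \<comment> \<open>Truncated subtraction caps the sum at 1, which yields the disjunction of two
    truth values.\<close>
  have "f (Suc n) e = 1 - (1 - (f n e + q e n))" for n e
    by (auto simp: f_def q_def less_Suc_eq)
  then have "computable (\<lambda>z. f (b z) z)"
    by (intro computable_rec[where f = f and g = "\<lambda>e. 0"
          and h = "\<lambda>y n e. 1 - (1 - (y + q e n))"])
      (auto simp: f_def intro!: computable_intros q' assms)
  then show ?thesis unfolding decidable_def f_def .
qed

lemma decidable_All [computable_intros]:
  assumes "computable b" and "decidable (\<lambda>z. Q (pfst z) (psnd z))"
  shows "decidable (\<lambda>z. \<forall>k<b z. Q z k)"
  using decidable_not[OF decidable_Ex[OF assms(1) decidable_not[OF assms(2)]]] by simp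

text \<open>Bit \<open>k\<close> of \<open>w\<close> is set iff \<open>w div 2 ^ k\<close> is odd.
  Division is avoided by guessing half of this odd quotient and the remainder, both of which are
  bounded.\<close>

lemma decidable_set_decode [computable_intros]:
  assumes "computable f" "computable g"
  shows "decidable (\<lambda>z. f z \<in> set_decode (g z))"
proof -
  have "k \<in> set_decode w \<longleftrightarrow> (\<exists>q<Suc w. \<exists>r<2 ^ k. w = (2 * q + 1) * 2 ^ k + r)" for k w
  proof
    assume "k \<in> set_decode w"
    then obtain q where q: "w div 2 ^ k = 2 * q + 1"
      by (auto simp: set_decode_def elim: oddE)
    have "q \<le> w div 2 ^ k" using q by simp
    moreover have "w div 2 ^ k \<le> w" by (rule div_le_dividend)
    moreover have "w = (2 * q + 1) * 2 ^ k + w mod 2 ^ k"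
      unfolding q[symmetric] by (rule div_mult_mod_eq[symmetric])
    moreover have "w mod 2 ^ k < 2 ^ k" by simp
    ultimately show "\<exists>q<Suc w. \<exists>r<2 ^ k. w = (2 * q + 1) * 2 ^ k + r"
      by (metis less_Suc_eq_le le_trans)
  next
    assume "\<exists>q<Suc w. \<exists>r<2 ^ k. w = (2 * q + 1) * 2 ^ k + r"
    then obtain q r where "r < 2 ^ k" "w = (2 * q + 1) * 2 ^ k + r" by blast
    then have "w div 2 ^ k = 2 * q + 1"
      using div_mult_self1[of "2 ^ k" r "2 * q + 1"] by (simp add: add.commute)
    then show "k \<in> set_decode w" by (simp add: set_decode_def)
  qed
  moreover have "decidable (\<lambda>z. \<exists>q<Suc (g z). \<exists>r<2 ^ f z. g z = (2 * q + 1) * 2 ^ f z + r)"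
  proof -
    \<comment> \<open>Below the quantifiers \<open>z\<close> turns into a projection of a larger
      tuple. Stating the formula for the two components of \<open>z\<close> keeps the rules
      applicable; \<open>f\<close> and \<open>g\<close> are substituted afterwards.\<close>
    have "decidable (\<lambda>z. \<exists>q<Suc (psnd z). \<exists>r<2 ^ pfst z. psnd z = (2 * q + 1) * 2 ^ pfst z + r)"
      by (intro computable_intros)
    from decidable_comp[OF this computable_pr[OF assms]] show ?thesis by simp
  qed
  ultimately show ?thesis by simp
qed

lemma decidable_iff [computable_intros]:
  "decidable Q \<Longrightarrow> decidable R \<Longrightarrow> decidable (\<lambda>z. Q z \<longleftrightarrow> R z)"
  unfolding iff_conv_conj_imp by (intro computable_intros)

section \<open>Lists coded as numbers\<close>

text \<open>A nonempty list is coded by the successor of a pair, hence the subtraction. The tail of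
  0 is 0 again, so \<open>code_drop\<close> stays at 0 past the end, and being 0 serves as the test
  for the end of the list.\<close>

definition code_tl :: "nat \<Rightarrow> nat" where
  "code_tl l = psnd (l - 1)"

definition code_drop :: "nat \<Rightarrow> nat \<Rightarrow> nat" where
  "code_drop i l = (code_tl ^^ i) l"

definition code_nth :: "nat \<Rightarrow> nat \<Rightarrow> nat" where
  "code_nth l i = pfst (code_drop i l - 1)"

lemma computable_code_drop [computable_intros]:
  "computable f \<Longrightarrow> computable g \<Longrightarrow> computable (\<lambda>z. code_drop (f z) (g z))"
  by (rule computable_rec[where g = "\<lambda>e. e" and h = "\<lambda>y n e. psnd (y - 1)"])
    (auto simp: code_drop_def code_tl_def intro!: computable_intros)

lemma computable_code_nth [computable_intros]:
  "computable f \<Longrightarrow> computable g \<Longrightarrow> computable (\<lambda>z. code_nth (f z) (g z))"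
  unfolding code_nth_def by (intro computable_intros)

lemma list_decode_code_tl: "list_decode (code_tl l) = tl (list_decode l)"
proof (cases l)
  case 0
  then show ?thesis using psnd_eq[of 0] by (simp add: code_tl_def)
qed (simp add: code_tl_def psnd_def split: prod.split)

lemma list_decode_code_drop: "list_decode (code_drop i l) = drop i (list_decode l)"
proof (induction i)
  case (Suc i)
  then show ?case
    by (simp add: code_drop_def list_decode_code_tl drop_Suc tl_drop)
qed (simp add: code_drop_def)

lemma list_decode_eq_Nil: "list_decode l = [] \<longleftrightarrow> l = 0"
  by (metis list_decode_inverse list_encode.simps(1) list_decode.simps(1))

lemma code_drop_eq_0: "code_drop i l = 0 \<longleftrightarrow> length (list_decode l) \<le> i"
  using list_decode_eq_Nil[of "code_drop i l"] by (auto simp: list_decode_code_drop)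

lemma code_nth: "i < length (list_decode l) \<Longrightarrow> code_nth l i = list_decode l ! i"
proof -
  assume i: "i < length (list_decode l)"
  then obtain m where m: "code_drop i l = Suc m"
    using code_drop_eq_0[of i l] by (metis leD not0_implies_Suc)
  have "drop i (list_decode l) = pfst m # list_decode (psnd m)"
    using list_decode_code_drop[of i l] unfolding m by (simp add: pfst_def psnd_def split_beta)
  then show ?thesis using m i by (simp add: code_nth_def nth_via_drop)
qed

lemma less_list_encode: "c \<in> set xs \<Longrightarrow> c < list_encode xs"
proof (induction xs)
  case (Cons a xs)
  have "a \<le> prod_encode (a, list_encode xs)" "list_encode xs \<le> prod_encode (a, list_encode xs)"
    by (simp_all add: le_prod_encode_1 le_prod_encode_2)
  with Cons show ?case by auto
qed simp

lemma length_le_list_encode: "length xs \<le> list_encode xs"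
proof (induction xs)
  case (Cons a xs)
  have "list_encode xs \<le> prod_encode (a, list_encode xs)" by (simp add: le_prod_encode_2)
  with Cons show ?case by auto
qed simp

lemma less_list_decode: "c \<in> set (list_decode l) \<Longrightarrow> c < l"
  using less_list_encode[of c "list_decode l"] by simp

lemma length_list_decode_le: "length (list_decode l) \<le> l"
  using length_le_list_encode[of "list_decode l"] by simp

lemma decidable_length [computable_intros]:
  assumes "computable f" "computable g"
  shows "decidable (\<lambda>z. length (list_decode (f z)) = g z)"
proof -
  have eq: "length (list_decode l) = n \<longleftrightarrow> code_drop n l = 0 \<and> (\<forall>i<n. code_drop i l \<noteq> 0)" for l n
    by (auto simp: code_drop_eq_0 not_le) (metis le_antisym nat_less_le not_le)
  have "decidable (\<lambda>z. length (list_decode (pfst z)) = psnd z)"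
    unfolding eq by (intro computable_intros)
  from decidable_comp[OF this computable_pr[OF assms]] show ?thesis by simp
qed

lemma decidable_mem_list [computable_intros]:
  assumes "computable f" "computable g"
  shows "decidable (\<lambda>z. f z \<in> set (list_decode (g z)))"
proof -
  have eq: "c \<in> set (list_decode l) \<longleftrightarrow> (\<exists>i<l. code_drop i l \<noteq> 0 \<and> code_nth l i = c)" for c l
  proof
    assume "c \<in> set (list_decode l)"
    then obtain i where "i < length (list_decode l)" "list_decode l ! i = c"
      by (auto simp: in_set_conv_nth)
    then show "\<exists>i<l. code_drop i l \<noteq> 0 \<and> code_nth l i = c"
      using length_list_decode_le[of l] by (intro exI[of _ i]) (auto simp: code_drop_eq_0 code_nth)
  qed (metis code_drop_eq_0 code_nth not_le nth_mem)
  have "decidable (\<lambda>z. pfst z \<in> set (list_decode (psnd z)))"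
    unfolding eq by (intro computable_intros)
  from decidable_comp[OF this computable_pr[OF assms]] show ?thesis by simp
qed

lemma decidable_Ball_list [computable_intros]:
  assumes "computable f" "decidable (\<lambda>z. Q (pfst z) (psnd z))"
  shows "decidable (\<lambda>z. \<forall>c\<in>set (list_decode (f z)). Q z c)"
proof -
  have "(\<forall>c\<in>set (list_decode (f z)). Q z c)
    \<longleftrightarrow> (\<forall>c<f z. c \<in> set (list_decode (f z)) \<longrightarrow> Q z c)" for z
    using less_list_decode by blast
  moreover have "decidable (\<lambda>z. \<forall>c<f z. c \<in> set (list_decode (f z)) \<longrightarrow> Q z c)"
    by (intro computable_intros assms computable_comp[OF assms(1)])
  ultimately show ?thesis by simp
qed

text \<open>Equality of the lengths is expressed by both lists ending at the same position.
  Positions up to \<open>l + m\<close> suffice, as a list is never longer than its code.\<close>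

lemma decidable_list_all2 [computable_intros]:
  assumes f: "computable f" and g: "computable g"
    and Q: "decidable (\<lambda>z. Q (pfst z) (pfst (psnd z)) (psnd (psnd z)))"
  shows "decidable (\<lambda>z. list_all2 (Q z) (list_decode (f z)) (list_decode (g z)))"
proof -
  have eq: "list_all2 R (list_decode l) (list_decode m) \<longleftrightarrow>
    (\<forall>i<l + m. (code_drop i l = 0 \<longleftrightarrow> code_drop i m = 0) \<and>
      (code_drop i l \<noteq> 0 \<longrightarrow> R (code_nth l i) (code_nth m i)))" (is "_ = ?r") for R l m
  proof
    assume ?r
    have "length (list_decode l) = length (list_decode m)"
    proof (rule ccontr)
      \<comment> \<open>The shorter list has ended at this position, the longer one has not.\<close>
      define i where "i = min (length (list_decode l)) (length (list_decode m))"
      assume "length (list_decode l) \<noteq> length (list_decode m)"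
      then have "\<not> (code_drop i l = 0 \<longleftrightarrow> code_drop i m = 0)" "i < l + m"
        using length_list_decode_le[of l] length_list_decode_le[of m]
        unfolding i_def code_drop_eq_0 by linarith+
      with \<open>?r\<close> show False by blast
    qed
    moreover have "R (list_decode l ! i) (list_decode m ! i)"
      if "i < length (list_decode l)" "i < length (list_decode m)" for i
    proof -
      have "i < l + m" using that(1) length_list_decode_le[of l] by linarith
      with \<open>?r\<close> that show ?thesis by (metis code_drop_eq_0 code_nth not_le)
    qed
    ultimately show "list_all2 R (list_decode l) (list_decode m)"
      by (auto simp: list_all2_conv_all_nth)
  qed (auto simp: list_all2_conv_all_nth code_drop_eq_0 code_nth)
  have Q': "decidable (\<lambda>z. Q (a z) (b z) (c z))"
    if "computable a" "computable b" "computable c" for a b c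
    using decidable_comp[OF Q computable_pr[OF that(1) computable_pr[OF that(2,3)]]] by simp
  show ?thesis
    unfolding eq by (intro computable_intros f g Q' computable_comp[OF f] computable_comp[OF g])
qed

section \<open>Numerical bounds for codes\<close>

text \<open>This is the code of the list of \<open>n\<close> copies of \<open>m\<close>. By
  monotonicity of pairing it dominates the codes of all lists of at most \<open>n\<close> entries
  that are at most \<open>m\<close>.\<close>

fun list_bound :: "nat \<Rightarrow> nat \<Rightarrow> nat" where
  "list_bound 0 m = 0"
| "list_bound (Suc n) m = Suc (pr m (list_bound n m))"

lemma computable_list_bound [computable_intros]:
  "computable f \<Longrightarrow> computable g \<Longrightarrow> computable (\<lambda>z. list_bound (f z) (g z))"
  by (rule computable_rec[where g = "\<lambda>e. 0" and h = "\<lambda>y n e. Suc (pr e y)"])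
    (auto intro!: computable_intros)

lemma pr_mono: "a \<le> a' \<Longrightarrow> b \<le> b' \<Longrightarrow> pr a b \<le> pr a' b'"
proof -
  assume *: "a \<le> a'" "b \<le> b'"
  have "triangle m \<le> triangle n" if "m \<le> n" for m n
    using that by (induction n rule: dec_induct) auto
  from this[of "a + b" "a' + b'"] * show ?thesis by (simp add: pr_def prod_encode_def)
qed

lemma pr_strict_mono:
  assumes "a < a'" "b \<le> b'" shows "pr a b < pr a' b'"
proof -
  have "pr a b \<noteq> pr a' b'" using assms(1) pfst_pr by (metis nat_less_le)
  with pr_mono[of a a' b b'] assms show ?thesis by linarith
qed

lemma list_encode_le_list_bound:
  assumes "\<forall>x\<in>set xs. x \<le> m" "length xs \<le> n"
  shows "list_encode xs \<le> list_bound n m"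
  using assms
proof (induction xs arbitrary: n)
  case (Cons a xs)
  then obtain k where "n = Suc k" by (cases n) auto
  with Cons show ?case using pr_mono[of a m "list_encode xs" "list_bound k m"]
    by (simp add: pr_def)
qed simp

text \<open>The powers of 2 below \<open>2 ^ n\<close> sum to \<open>2 ^ n - 1\<close>. This turns
  quantification over subsets of an initial segment into bounded quantification over
  numbers.\<close>

lemma set_encode_less:
  assumes "A \<subseteq> {..<n}" shows "set_encode A < 2 ^ n"
proof -
  have "set_encode A \<le> set_encode {..<n}"
    unfolding set_encode_def by (rule sum_mono2) (use assms in auto)
  also have "\<dots> < 2 ^ n"
    by (simp add: set_encode_def lessThan_atLeast0 sum_power2)
  finally show ?thesis .
qed

section \<open>Certificates for satisfiability\<close>

text \<open>An element of the finite algebra is a number read as a bit set: bit \<open>2 * p\<close> says that predicate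
  \<open>p\<close> holds, bit \<open>2 * s + 1\<close> that the pattern coded by \<open>s\<close> is \<^emph>\<open>not\<close> matched. \<open>U\<close> is the carrier,
  \<open>W\<close> contains \<open>pr f (pr l d)\<close> if \<open>f\<close> maps the argument list coded by \<open>l\<close> to \<open>d\<close>, and \<open>v\<close> contains
  \<open>pr c d\<close> if the term coded by \<open>c\<close> has value \<open>d\<close>.\<close>
definition consistent :: "nat \<Rightarrow> nat \<Rightarrow> nat \<Rightarrow> nat set \<Rightarrow> nat set \<Rightarrow> nat set \<Rightarrow> bool" where
  "consistent B M D U W v \<longleftrightarrow> (\<forall>c<B. \<forall>d<M. pr c d \<in> v \<longrightarrow>
     (\<forall>e<M. pr c e \<in> v \<longrightarrow> d = e) \<and>
     (pfst c = 0 \<longrightarrow> d \<in> U) \<and>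
     (pfst c = 1 \<longrightarrow> (\<exists>l<D.
        list_all2 (\<lambda>b e. pr b e \<in> v) (list_decode (psnd (psnd c))) (list_decode l) \<and>
        pr (pfst (psnd c)) (pr l d) \<in> W)))"

text \<open>The condition \<open>pfst g = 0\<close> admits only predicate atoms as true antecedents,
  in accordance with interpretations that contain no equation.\<close>

definition falsified :: "nat \<Rightarrow> nat set \<Rightarrow> nat \<Rightarrow> bool" where
  "falsified M v cc \<longleftrightarrow>
     (\<forall>g\<in>set (list_decode (pfst (pfst cc))). pfst g = 0 \<and>
        (\<exists>d<M. pr (psnd (psnd g)) d \<in> v \<and> 2 * pfst (psnd g) \<in> set_decode d)) \<and>
     (\<forall>g\<in>set (list_decode (psnd (pfst cc))).
        \<exists>d<M. pr (psnd (psnd g)) d \<in> v \<and> 2 * pfst (psnd g) \<notin> set_decode d) \<and>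
     (\<forall>q\<in>set (list_decode (psnd cc)).
        \<exists>d<M. pr (pfst q) d \<in> v \<and> Suc (2 * psnd q) \<in> set_decode d)"

text \<open>Only an unset odd bit, the claim that a pattern is matched, has to be justified by the
  arguments. A spurious set bit merely makes it easier to falsify clauses, so it cannot make a
  certificate unsound. Predicate bits are unconstrained because every choice of them defines an
  interpretation. \<open>W\<close> may relate several results to the same arguments: the clauses are
  tested against all of them.\<close>

definition closed_algebra :: "nat \<Rightarrow> nat \<Rightarrow> nat \<Rightarrow> nat \<Rightarrow> nat set \<Rightarrow> nat set \<Rightarrow> bool" where
  "closed_algebra B M D sig U W \<longleftrightarrow> (\<forall>s\<in>set (list_decode sig). \<forall>l<D.
     length (list_decode l) = psnd s \<and> (\<forall>d\<in>set (list_decode l). d \<in> U) \<longrightarrow>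
     (\<exists>d<M. d \<in> U \<and> pr (pfst s) (pr l d) \<in> W \<and>
        (\<forall>p<B. Suc (2 * p) \<notin> set_decode d \<longrightarrow>
           pfst p = 0 \<or> (pfst p = 1 \<and> pfst (psnd p) = pfst s \<and>
             list_all2 (\<lambda>q e. Suc (2 * q) \<notin> set_decode e)
               (list_decode (psnd (psnd p))) (list_decode l)))))"

abbreviation certificate :: "nat \<Rightarrow> nat \<Rightarrow> nat \<Rightarrow> nat \<Rightarrow> nat set \<Rightarrow> nat set \<Rightarrow> bool" where
  "certificate x B M D U W \<equiv> closed_algebra B M D (pfst x) U W \<and>
     (\<forall>cc\<in>set (list_decode (psnd x)). \<forall>v<2 ^ pr B M.
        \<not> (consistent B M D U W (set_decode v) \<and> falsified M (set_decode v) cc))"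

text \<open>Predicates and patterns have codes at most \<open>x\<close>, so the bit positions
  \<open>2 * p\<close> and \<open>2 * s + 1\<close> are below \<open>2 * Suc x\<close>.\<close>

definition element_bound :: "nat \<Rightarrow> nat" where
  "element_bound x = 2 ^ (2 * Suc x)"

text \<open>Arities are at most the code \<open>x\<close> of the input, so argument lists have at
  most \<open>x\<close> entries.\<close>

definition args_bound :: "nat \<Rightarrow> nat" where
  "args_bound x = Suc (list_bound x (element_bound x))"

definition certifiable :: "nat \<Rightarrow> bool" where
  "certifiable x \<longleftrightarrow> (\<exists>u<2 ^ element_bound x.
     \<exists>w<2 ^ pr (Suc x) (pr (args_bound x) (element_bound x)).
       certificate x (Suc x) (element_bound x) (args_bound x) (set_decode u) (set_decode w))"

lemma decidable_certifiable: "decidable certifiable"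
proof -
  have "decidable (\<lambda>x. certifiable x)"
    unfolding certifiable_def element_bound_def args_bound_def consistent_def falsified_def
      closed_algebra_def
    by (intro computable_intros)
  then show ?thesis by simp
qed

section \<open>Matching against linear patterns\<close>

text \<open>Repeated variables of the pattern are ignored. Unlike \<open>instance_of\<close>, this
  relation treats the arguments independently, so that the patterns matched by a compound term can
  be computed from those of its arguments; on straight patterns both relations agree.\<close>

fun lmatch :: "trm \<Rightarrow> trm \<Rightarrow> bool" where
  "lmatch t (V y) = True"
| "lmatch (V x) (F g ps) = False"
| "lmatch (F f ts) (F g ps) = (f = g \<and> list_all2 lmatch ts ps)"

lemma set_var_occs: "set (var_occs t) = vars t"
  by (induction t) auto

lemma subst_cong: "(\<And>y. y \<in> vars t \<Longrightarrow> \<sigma> y = \<tau> y) \<Longrightarrow> subst t \<sigma> = subst t \<tau>"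
  by (induction t) auto

lemma instance_imp_lmatch: "lmatch (subst s \<sigma>) s"
  by (induction s) (auto simp: list_all2_conv_all_nth)

lemma distinct_concat_nth:
  assumes "distinct (concat xss)" "i < length xss" "j < length xss"
    and "y \<in> set (xss ! i)" "y \<in> set (xss ! j)"
  shows "i = j"
  using assms
proof (induction xss arbitrary: i j)
  case (Cons xs xss)
  have "\<not> (y \<in> set xs \<and> k < length xss \<and> y \<in> set (xss ! k))" for k
    using Cons.prems(1) by (fastforce simp: disjoint_iff dest: nth_mem)
  with Cons show ?case by (cases i; cases j) auto
qed simp

lemma distinct_var_occs_args:
  assumes "distinct (concat (map var_occs ts))" "i < length ts" "j < length ts"
    and "y \<in> vars (ts ! i)" "y \<in> vars (ts ! j)"
  shows "i = j"
  using distinct_concat_nth[of "map var_occs ts" i j y] assms by (simp add: set_var_occs)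

text \<open>No variable occurs in two arguments, so \<open>SOME\<close> selects the only argument
  containing \<open>y\<close>, and substitutions given for each argument separately merge into
  one.\<close>

lemma subst_glue:
  assumes "distinct (concat (map var_occs ts))"
  obtains \<sigma> where "\<And>i y. i < length ts \<Longrightarrow> y \<in> vars (ts ! i) \<Longrightarrow> \<sigma> y = \<tau> i y"
proof -
  define \<sigma> where "\<sigma> y = \<tau> (SOME i. i < length ts \<and> y \<in> vars (ts ! i)) y" for y
  have "\<sigma> y = \<tau> i y" if "i < length ts" "y \<in> vars (ts ! i)" for i y
  proof -
    have "(SOME i. i < length ts \<and> y \<in> vars (ts ! i)) = i"
      using that distinct_var_occs_args[OF assms] by (intro some_equality) auto
    then show ?thesis unfolding \<sigma>_def by simp
  qed
  then show ?thesis by (rule that)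
qed

lemma linear_lmatch_imp_instance:
  "linear s \<Longrightarrow> lmatch t s \<Longrightarrow> instance_of t s"
  unfolding instance_of_def linear_def
proof (induction t s rule: lmatch.induct)
  case (3 f ts g ps)
  then have len: "length ts = length ps" by (auto simp: list_all2_lengthD)
  have "\<exists>\<sigma>. subst (ps ! i) \<sigma> = ts ! i" if "i < length ps" for i
  proof (rule "3.IH")
    show "ts ! i \<in> set ts" "ps ! i \<in> set ps" using that len by auto
    show "distinct (var_occs (ps ! i))"
      using "3.prems"(1) that by (auto simp: distinct_concat_iff)
    show "lmatch (ts ! i) (ps ! i)" using "3.prems"(2) that by (auto simp: list_all2_conv_all_nth)
  qed
  then obtain \<tau> where \<tau>: "\<And>i. i < length ps \<Longrightarrow> subst (ps ! i) (\<tau> i) = ts ! i" by metis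
  obtain \<sigma> where \<sigma>: "\<And>i y. i < length ps \<Longrightarrow> y \<in> vars (ps ! i) \<Longrightarrow> \<sigma> y = \<tau> i y"
    using subst_glue[of ps \<tau>] "3.prems"(1) by auto
  have "subst (ps ! i) \<sigma> = ts ! i" if "i < length ps" for i
    using \<tau>[OF that] subst_cong[of "ps ! i" \<sigma> "\<tau> i"] \<sigma>[OF that] by simp
  then have "map (\<lambda>p. subst p \<sigma>) ps = ts" using len by (simp add: list_eq_iff_nth_eq)
  with "3.prems"(2) show ?case by auto
qed auto

lemma straight_imp_linear: "straight s \<Longrightarrow> linear s"
  by (cases s) (auto simp: linear_def)

lemma enc_trm_inj: "enc_trm s = enc_trm t \<Longrightarrow> s = t"
proof (induction s arbitrary: t)
  case (V x) then show ?case by (cases t) auto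
next
  case (F f ss)
  then obtain ts where t: "t = F f ts" and "map enc_trm ss = map enc_trm ts"
    by (cases t) (auto simp: list_encode_eq)
  then have "ss = ts"
    using F.IH by (auto simp: list_eq_iff_nth_eq)
  with t show ?case by simp
qed

lemma enc_trm_arg_less: "s \<in> set ts \<Longrightarrow> enc_trm s < enc_trm (F f ts)"
  using less_list_encode[of "enc_trm s" "map enc_trm ts"]
    le_prod_encode_2[of "list_encode (map enc_trm ts)" f]
    le_prod_encode_2[of "prod_encode (f, list_encode (map enc_trm ts))" 1]
  by simp

text \<open>A bound on codes is used because arguments have smaller codes than the term: the
  patterns considered are closed under subterms, and they include every right-hand side and every
  constant of a clause with code at most \<open>b\<close>.\<close>

definition pats :: "nat \<Rightarrow> trm \<Rightarrow> trm set" where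
  "pats b t = {p. enc_trm p \<le> b \<and> lmatch t p}"

lemma pats_F_cong:
  assumes "list_all2 (\<lambda>u t. pats b u = pats b t) us ts"
  shows "pats b (F f us) = pats b (F f ts)"
proof -
  have "lmatch (F f us) p \<longleftrightarrow> lmatch (F f ts) p" if p: "enc_trm p \<le> b" for p
  proof (cases p)
    case (F g ps)
    have "lmatch (us ! i) (ps ! i) \<longleftrightarrow> lmatch (ts ! i) (ps ! i)"
      if "i < length us" "i < length ps" for i
    proof -
      have "enc_trm (ps ! i) \<le> b" using enc_trm_arg_less[of "ps ! i" ps g] that p F by simp
      moreover have "pats b (us ! i) = pats b (ts ! i)"
        using assms that by (auto simp: list_all2_conv_all_nth)
      ultimately show ?thesis unfolding pats_def by blast
    qed
    with assms F show ?thesis by (auto simp: list_all2_conv_all_nth)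
  qed simp
  then show ?thesis unfolding pats_def by blast
qed

text \<open>A constant is a pattern matched by itself alone. This fixes those arguments of a
  succedent atom that no substitution can change.\<close>

lemma pats_const:
  assumes "pats b u = pats b (F c [])" "enc_trm (F c []) \<le> b"
  shows "u = F c []"
proof -
  have "lmatch u (F c [])" using assms unfolding pats_def by fastforce
  then show ?thesis by (cases u) auto
qed

section \<open>The canonical interpretation\<close>

definition preds :: "nat \<Rightarrow> atom set \<Rightarrow> trm \<Rightarrow> nat set" where
  "preds b I t = {p. p \<le> b \<and> P p t \<in> I}"

text \<open>The intersection makes the predicates true of \<open>F f ts\<close> depend only on \<open>f\<close> and on the
  predicates and patterns of the arguments, while making fewer atoms true than \<open>I\<close> does.\<close>
function cpreds :: "nat \<Rightarrow> signature \<Rightarrow> atom set \<Rightarrow> trm \<Rightarrow> nat set" where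
  "cpreds b \<Sigma> I (V y) = {}"
| "cpreds b \<Sigma> I (F f ts) = {p. p \<le> b \<and> (\<forall>us. list_all2 (\<lambda>u t. ground_term \<Sigma> u \<and>
     cpreds b \<Sigma> I t \<subseteq> preds b I u \<and> pats b u = pats b t) us ts \<longrightarrow> P p (F f us) \<in> I)}"
  by pat_completeness auto
termination by (relation "measure (\<lambda>(b, \<Sigma>, I, t). size t)") (auto simp: less_Suc_eq_le size_list_estimation')

text \<open>The term \<open>u\<close> may replace \<open>t\<close> when a counterexample is moved
  back to \<open>I\<close>. The two sides are deliberately measured differently: \<open>t\<close> by
  the new interpretation, \<open>u\<close> by the given one.\<close>

definition below :: "nat \<Rightarrow> signature \<Rightarrow> atom set \<Rightarrow> trm \<Rightarrow> trm \<Rightarrow> bool" where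
  "below b \<Sigma> I u t \<longleftrightarrow>
     ground_term \<Sigma> u \<and> cpreds b \<Sigma> I t \<subseteq> preds b I u \<and> pats b u = pats b t"

lemma in_cpreds_F: "p \<in> cpreds b \<Sigma> I (F f ts) \<longleftrightarrow>
    p \<le> b \<and> (\<forall>us. list_all2 (below b \<Sigma> I) us ts \<longrightarrow> P p (F f us) \<in> I)"
  unfolding below_def by simp

declare cpreds.simps(2) [simp del]

lemma cpreds_F_cong:
  assumes "list_all2 (\<lambda>u t. cpreds b \<Sigma> I u = cpreds b \<Sigma> I t \<and> pats b u = pats b t) us ts"
  shows "cpreds b \<Sigma> I (F f us) = cpreds b \<Sigma> I (F f ts)"
proof -
  have "below b \<Sigma> I v (us ! i) \<longleftrightarrow> below b \<Sigma> I v (ts ! i)" if "i < length ts" for v i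
    using assms that by (simp add: list_all2_conv_all_nth below_def)
  then have "list_all2 (below b \<Sigma> I) vs us \<longleftrightarrow> list_all2 (below b \<Sigma> I) vs ts" for vs
    using list_all2_lengthD[OF assms] by (auto simp: list_all2_conv_all_nth)
  then show ?thesis by (auto simp: in_cpreds_F)
qed

lemma cpreds_le: "p \<in> cpreds b \<Sigma> I t \<Longrightarrow> p \<le> b"
  by (cases t) (auto simp: in_cpreds_F)

lemma ground_term_F:
  "ground_term \<Sigma> (F f ts) \<longleftrightarrow> (f, length ts) \<in> set \<Sigma> \<and> (\<forall>t\<in>set ts. ground_term \<Sigma> t)"
  by (auto simp: ground_term_def list_all_iff)

text \<open>The tuple \<open>us\<close> is one of those over which the predicates of
  \<open>F f ts\<close> are intersected.\<close>

lemma below_F: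
  assumes us: "list_all2 (below b \<Sigma> I) us ts" and f: "(f, length ts) \<in> set \<Sigma>"
  shows "below b \<Sigma> I (F f us) (F f ts)"
  unfolding below_def
proof (intro conjI)
  show "ground_term \<Sigma> (F f us)"
    using us f by (auto simp: ground_term_F list_all2_conv_all_nth below_def in_set_conv_nth)
  show "cpreds b \<Sigma> I (F f ts) \<subseteq> preds b I (F f us)"
    using us by (auto simp: in_cpreds_F preds_def)
  show "pats b (F f us) = pats b (F f ts)"
    by (rule pats_F_cong) (rule list_all2_mono[OF us], simp add: below_def)
qed

text \<open>By induction every ground term takes part in its own intersection. In particular the new
  interpretation only contains atoms of \<open>I\<close>, and a variable may keep its value.\<close>

lemma below_refl: "ground_term \<Sigma> t \<Longrightarrow> below b \<Sigma> I t t"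
proof (induction t)
  case (V y) then show ?case by (simp add: ground_term_def)
next
  case (F f ts)
  then show ?case by (intro below_F) (auto simp: ground_term_F list_all2_conv_all_nth)
qed

text \<open>Replacement propagates through contexts of any depth, as the terms in antecedents and
  disequations require.\<close>

lemma below_subst:
  assumes "wf_term \<Sigma> s" "\<And>y. y \<in> vars s \<Longrightarrow> below b \<Sigma> I (\<delta>' y) (\<delta> y)"
  shows "below b \<Sigma> I (subst s \<delta>') (subst s \<delta>)"
  using assms
proof (induction s)
  case (F f ts)
  have "list_all2 (below b \<Sigma> I) (map (\<lambda>t. subst t \<delta>') ts) (map (\<lambda>t. subst t \<delta>) ts)"
    unfolding list_all2_map1 list_all2_map2
    using F by (intro list_all2_all_nthI) (auto simp: list_all_iff, metis nth_mem)
  moreover have "(f, length (map (\<lambda>t. subst t \<delta>) ts)) \<in> set \<Sigma>" using F.prems(1) by simp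
  ultimately show ?case using below_F by simp
qed simp

lemma shallow_arg_cases:
  assumes "shallow (F f ts)" "i < length ts"
  obtains y where "ts ! i = V y" | c where "ts ! i = F c []"
proof (cases "ts ! i")
  case (F c us)
  have "depth (ts ! i) \<le> Max (set (map depth ts))" using assms(2) by (intro Max_ge) auto
  moreover have "ts \<noteq> []" using assms(2) by auto
  ultimately have "depth (ts ! i) = 0" using assms(1) by (simp add: shallow_def)
  with F have "us = []" by (auto split: if_splits)
  with F show ?thesis using that(2) by simp
qed (use that(1) in simp)

text \<open>Linearity and shallowness of a succedent atom allow any choice of arguments of its head symbol
  to be realised by a substitution; arguments that are constants are pinned down by the patterns.\<close>
lemma refute_atom:
  assumes s: "shallow s" "linear s" "enc_trm s \<le> b"
    and \<delta>: "\<And>y. y \<in> vars s \<Longrightarrow> ground_term \<Sigma> (\<delta> y)"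
    and p: "p \<le> b" "p \<notin> cpreds b \<Sigma> I (subst s \<delta>)"
  shows "\<exists>\<delta>'. (\<forall>y\<in>vars s. below b \<Sigma> I (\<delta>' y) (\<delta> y)) \<and> P p (subst s \<delta>') \<notin> I"
proof (cases s)
  case (V y)
  have g: "ground_term \<Sigma> (\<delta> y)" using \<delta> V by simp
  then obtain f ts where t: "\<delta> y = F f ts" by (cases "\<delta> y") (auto simp: ground_term_def)
  \<comment> \<open>When the atom is a predicate of a variable, the refuting arguments are placed
    below the head symbol of the value of that variable.\<close>
  with p V obtain us where us: "list_all2 (below b \<Sigma> I) us ts" "P p (F f us) \<notin> I"
    by (auto simp: in_cpreds_F)
  have "below b \<Sigma> I (F f us) (\<delta> y)"
    using below_F[OF us(1)] g unfolding t ground_term_F by blast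
  with us(2) V show ?thesis by (intro exI[of _ "\<lambda>_. F f us"]) simp
next
  case (F f ts)
  with p obtain us
    where us: "list_all2 (below b \<Sigma> I) us (map (\<lambda>t. subst t \<delta>) ts)" "P p (F f us) \<notin> I"
    by (auto simp: in_cpreds_F)
  have len: "length us = length ts" using us(1) by (auto dest: list_all2_lengthD)
  \<comment> \<open>An argument containing a variable is that variable itself, so it can be sent to
    the chosen term directly.\<close>
  obtain \<delta>' where \<delta>': "\<And>i y. i < length ts \<Longrightarrow> y \<in> vars (ts ! i) \<Longrightarrow> \<delta>' y = us ! i"
    using subst_glue[of ts "\<lambda>i y. us ! i"] s(2) F by (auto simp: linear_def)
  have arg: "below b \<Sigma> I (us ! i) (subst (ts ! i) \<delta>)" if "i < length ts" for i
    using us(1) that by (auto simp: list_all2_conv_all_nth)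
  have "subst (ts ! i) \<delta>' = us ! i" if i: "i < length ts" for i
    using shallow_arg_cases[OF s(1)[unfolded F] i]
  proof cases
    case (1 y) then show ?thesis using \<delta>'[OF i] by simp
  next
    case (2 c)
    have "enc_trm (F c []) \<le> b" using enc_trm_arg_less[of "ts ! i" ts f] i s(3) F 2
      by (metis le_trans less_imp_le_nat nth_mem)
    moreover have "pats b (us ! i) = pats b (F c [])" using arg[OF i] 2 by (simp add: below_def)
    ultimately have "us ! i = F c []" by (intro pats_const)
    with 2 show ?thesis by simp
  qed
  then have "map (\<lambda>t. subst t \<delta>') ts = us" using len by (simp add: list_eq_iff_nth_eq)
  then have "P p (subst s \<delta>') \<notin> I" using us(2) F by simp
  moreover have "below b \<Sigma> I (\<delta>' y) (\<delta> y)" if "y \<in> vars s" for y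
  proof -
    from that F obtain i where i: "i < length ts" "y \<in> vars (ts ! i)"
      by (auto simp: in_set_conv_nth)
    have "ts ! i = V y" using shallow_arg_cases[OF s(1)[unfolded F] i(1)]
      by cases (use i(2) in simp_all)
    with arg[OF i(1)] \<delta>'[OF i] show ?thesis by simp
  qed
  ultimately show ?thesis by blast
qed

lemma enc_atom_bounds:
  "p \<le> enc_atom (P p t)" "enc_trm t \<le> enc_atom (P p t)"
  using le_prod_encode_1[of p "enc_trm t"] le_prod_encode_2[of "enc_trm t" p]
    le_prod_encode_2[of "prod_encode (p, enc_trm t)" 0]
  by simp_all

lemma enc_cclause_atom_le:
  assumes "A \<in> set \<Gamma> \<union> set \<Delta>"
  shows "enc_atom A \<le> enc_cclause ((\<Gamma>, \<Delta>), \<pi>)"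
proof -
  let ?g = "list_encode (map enc_atom \<Gamma>)" and ?d = "list_encode (map enc_atom \<Delta>)"
  have "enc_atom A < ?g \<or> enc_atom A < ?d"
    using assms less_list_encode[of "enc_atom A" "map enc_atom \<Gamma>"]
      less_list_encode[of "enc_atom A" "map enc_atom \<Delta>"] by auto
  then show ?thesis
    using le_prod_encode_1[of ?g ?d] le_prod_encode_2[of ?d ?g]
      le_prod_encode_1[of "prod_encode (?g, ?d)"
        "list_encode (map (\<lambda>(t, s). prod_encode (enc_trm t, enc_trm s)) \<pi>)"]
    unfolding enc_cclause_def Let_def prod.case by linarith
qed

lemma enc_cclause_sdc_le:
  assumes "(t, s) \<in> set \<pi>"
  shows "enc_trm t \<le> enc_cclause ((\<Gamma>, \<Delta>), \<pi>)" "enc_trm s \<le> enc_cclause ((\<Gamma>, \<Delta>), \<pi>)"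
proof -
  let ?e = "\<lambda>(t, s). prod_encode (enc_trm t, enc_trm s)"
  have "prod_encode (enc_trm t, enc_trm s) < list_encode (map ?e \<pi>)"
    using assms by (intro less_list_encode) force
  also have "\<dots> \<le> enc_cclause ((\<Gamma>, \<Delta>), \<pi>)" by (simp add: enc_cclause_def le_prod_encode_2)
  finally show "enc_trm t \<le> enc_cclause ((\<Gamma>, \<Delta>), \<pi>)" "enc_trm s \<le> enc_cclause ((\<Gamma>, \<Delta>), \<pi>)"
    using le_prod_encode_1[of "enc_trm t" "enc_trm s"] le_prod_encode_2[of "enc_trm s" "enc_trm t"]
    by linarith+
qed

definition canonical :: "nat \<Rightarrow> signature \<Rightarrow> atom set \<Rightarrow> atom set" where
  "canonical b \<Sigma> I = {P p t | p t. p \<in> cpreds b \<Sigma> I t}"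

lemma canonical_P [simp]: "P p t \<in> canonical b \<Sigma> I \<longleftrightarrow> p \<in> cpreds b \<Sigma> I t"
  and canonical_Eq [simp]: "Eq s t \<notin> canonical b \<Sigma> I"
  by (simp_all add: canonical_def)

text \<open>An instance \<open>\<delta>\<close> falsified in the new interpretation is turned into
  an instance \<open>\<delta>'\<close> falsified in \<open>I\<close>. Each succedent atom brings its
  own refuting substitution; merged, they preserve the antecedents and all matched patterns, hence
  also the disequations.\<close>

lemma sat_canonical:
  assumes sat: "sat_cclause \<Sigma> I cc" and cc: "msl_sdc_clause \<Sigma> cc" "enc_cclause cc \<le> b"
  shows "sat_cclause \<Sigma> (canonical b \<Sigma> I) cc"
proof (rule ccontr)
  obtain \<Gamma> \<Delta> \<pi> where C: "cc = ((\<Gamma>, \<Delta>), \<pi>)" by (metis surj_pair)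
  assume "\<not> ?thesis"
  then obtain \<delta> where gr: "\<forall>x\<in>cclause_vars cc. ground_term \<Sigma> (\<delta> x)"
    and sol: "sdc_solution \<pi> \<delta>"
    and neg: "\<not> sat_ground (canonical b \<Sigma> I) (clause_subst (\<Gamma>, \<Delta>) \<delta>)"
    unfolding sat_cclause_def ground_instance_subst_def C by auto
  from neg have \<Gamma>: "\<And>A. A \<in> set \<Gamma> \<Longrightarrow> atom_subst A \<delta> \<in> canonical b \<Sigma> I"
    and \<Delta>: "\<And>A. A \<in> set \<Delta> \<Longrightarrow> atom_subst A \<delta> \<notin> canonical b \<Sigma> I"
    unfolding sat_ground_def clause_subst_def by auto
  have lin: "\<And>A. A \<in> set \<Delta> \<Longrightarrow> \<exists>p t. A = P p t \<and> shallow t \<and> linear t"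
    and disj: "\<And>A B. A \<in> set \<Delta> \<Longrightarrow> B \<in> set \<Delta> \<Longrightarrow> A \<noteq> B \<Longrightarrow> atom_vars A \<inter> atom_vars B = {}"
    using cc(1) by (auto simp: C msl_sdc_clause_def msl_clause_def)
  have wf: "\<And>A. A \<in> set \<Gamma> \<union> set \<Delta> \<Longrightarrow> wf_atom \<Sigma> A"
    and wf_sdc: "\<And>t s. (t, s) \<in> set \<pi> \<Longrightarrow> wf_term \<Sigma> t"
    and str: "\<And>t s. (t, s) \<in> set \<pi> \<Longrightarrow> straight s"
    using cc(1) by (auto simp: C msl_sdc_clause_def wf_cclause_def list_all_iff is_sdc_def)
  have "\<exists>\<delta>'. (\<forall>y\<in>atom_vars A. below b \<Sigma> I (\<delta>' y) (\<delta> y)) \<and> atom_subst A \<delta>' \<notin> I"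
    if A: "A \<in> set \<Delta>" for A
  proof -
    from lin[OF A] obtain p t where pt: "A = P p t" "shallow t" "linear t" by blast
    have "enc_atom A \<le> b" using enc_cclause_atom_le[of A \<Gamma> \<Delta> \<pi>] A cc(2) C by simp
    with pt(1) have "enc_trm t \<le> b" "p \<le> b" using enc_atom_bounds[where t = t and p = p] by simp_all
    moreover have "ground_term \<Sigma> (\<delta> y)" if "y \<in> vars t" for y
      using gr that A pt(1) by (force simp: C cclause_vars_def)
    moreover have "p \<notin> cpreds b \<Sigma> I (subst t \<delta>)" using \<Delta>[OF A] pt(1) by simp
    ultimately show ?thesis using refute_atom[of t b \<Sigma> \<delta> p I] pt by simp
  qed
  then obtain D where D: "\<And>A y. A \<in> set \<Delta> \<Longrightarrow> y \<in> atom_vars A \<Longrightarrow> below b \<Sigma> I (D A y) (\<delta> y)"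
    "\<And>A. A \<in> set \<Delta> \<Longrightarrow> atom_subst A (D A) \<notin> I"
    by metis
  \<comment> \<open>Distinct succedent atoms share no variables, so the atom selected is unique.
    Variables outside the succedent keep their values.\<close>
  define \<delta>' where "\<delta>' y = (if \<exists>A\<in>set \<Delta>. y \<in> atom_vars A
    then D (SOME A. A \<in> set \<Delta> \<and> y \<in> atom_vars A) y else \<delta> y)" for y
  have \<delta>'_eq: "\<delta>' y = D A y" if "A \<in> set \<Delta>" "y \<in> atom_vars A" for A y
  proof -
    have "(SOME A. A \<in> set \<Delta> \<and> y \<in> atom_vars A) = A"
      using that disj by (intro some_equality) blast+
    with that show ?thesis unfolding \<delta>'_def by auto
  qed
  have below: "below b \<Sigma> I (\<delta>' y) (\<delta> y)" if y: "y \<in> cclause_vars cc" for y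
  proof (cases "\<exists>A\<in>set \<Delta>. y \<in> atom_vars A")
    case True then show ?thesis using \<delta>'_eq D(1) by metis
  next
    case False
    then have "\<delta>' y = \<delta> y" unfolding \<delta>'_def by simp
    then show ?thesis using below_refl gr y by simp
  qed
  have below_atom: "below b \<Sigma> I (subst t \<delta>') (subst t \<delta>)" if "P p t \<in> set \<Gamma>" for p t
    using wf[of "P p t"] that below
    by (intro below_subst) (force simp: C cclause_vars_def)+
  \<comment> \<open>A true antecedent cannot be an equation here.\<close>
  have "\<exists>p t. A = P p t" if "A \<in> set \<Gamma>" for A
    using \<Gamma>[OF that] by (cases A) auto
  then have "atom_subst A \<delta>' \<in> I" if "A \<in> set \<Gamma>" for A
    using \<Gamma>[OF that] below_atom that by (fastforce simp: below_def preds_def)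
  moreover have "atom_subst A \<delta>' \<notin> I" if A: "A \<in> set \<Delta>" for A
  proof -
    obtain p t where pt: "A = P p t" using lin[OF A] by blast
    have "subst t \<delta>' = subst t (D A)" using \<delta>'_eq[OF A] pt by (intro subst_cong) simp
    with D(2)[OF A] pt show ?thesis by simp
  qed
  moreover have "sdc_solution \<pi> \<delta>'"
    unfolding sdc_solution_def
  proof (clarify)
    fix t s assume ts: "(t, s) \<in> set \<pi>" and inst: "instance_of (subst t \<delta>') s"
    have "below b \<Sigma> I (subst t \<delta>') (subst t \<delta>)"
      using wf_sdc[OF ts] below ts by (intro below_subst) (force simp: C cclause_vars_def)+
    then have "pats b (subst t \<delta>') = pats b (subst t \<delta>)" by (simp add: below_def)
    moreover have "enc_trm s \<le> b" using enc_cclause_sdc_le(2)[OF ts, of \<Gamma> \<Delta>] cc(2) C by simp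
    moreover have "lmatch (subst t \<delta>') s"
      using inst instance_imp_lmatch unfolding instance_of_def by metis
    ultimately have "lmatch (subst t \<delta>) s" unfolding pats_def by blast
    then have "instance_of (subst t \<delta>) s"
      using linear_lmatch_imp_instance straight_imp_linear str[OF ts] by blast
    with sol ts show False unfolding sdc_solution_def by blast
  qed
  moreover have "\<forall>x\<in>cclause_vars cc. ground_term \<Sigma> (\<delta>' x)"
    using below by (simp add: below_def)
  ultimately have "ground_instance_subst \<Sigma> cc \<delta>'"
    and "\<not> sat_ground I (clause_subst (fst cc) \<delta>')"
    unfolding ground_instance_subst_def sat_ground_def clause_subst_def C by auto
  then show False using sat unfolding sat_cclause_def by blast
qed

section \<open>From a model to a finite algebra\<close>

text \<open>Numbers up to \<open>b\<close> that code no term also count as patterns not matched;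
  this is harmless, since a certificate only has to justify unset odd bits.\<close>

definition element :: "nat \<Rightarrow> signature \<Rightarrow> atom set \<Rightarrow> trm \<Rightarrow> nat" where
  "element b \<Sigma> I t = set_encode
     ((\<lambda>p. 2 * p) ` cpreds b \<Sigma> I t \<union> (\<lambda>s. Suc (2 * s)) ` ({..b} - enc_trm ` pats b t))"

lemma element_less: "element b \<Sigma> I t < 2 ^ (2 * Suc b)"
  unfolding element_def by (rule set_encode_less) (auto dest: cpreds_le)

lemma set_decode_element: "set_decode (element b \<Sigma> I t) =
    (\<lambda>p. 2 * p) ` cpreds b \<Sigma> I t \<union> (\<lambda>s. Suc (2 * s)) ` ({..b} - enc_trm ` pats b t)"
proof -
  have "finite (cpreds b \<Sigma> I t)" by (rule finite_subset[of _ "{..b}"]) (auto dest: cpreds_le)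
  then show ?thesis unfolding element_def by simp
qed

lemma even_in_element: "2 * p \<in> set_decode (element b \<Sigma> I t) \<longleftrightarrow> p \<in> cpreds b \<Sigma> I t"
proof -
  have "2 * p \<noteq> Suc (2 * s)" for s by presburger
  then show ?thesis unfolding set_decode_element by auto
qed

lemma odd_in_element:
  "Suc (2 * s) \<in> set_decode (element b \<Sigma> I t) \<longleftrightarrow> s \<le> b \<and> s \<notin> enc_trm ` pats b t"
proof -
  have "Suc (2 * s) \<noteq> 2 * p" for p by presburger
  then show ?thesis unfolding set_decode_element by auto
qed

lemma element_eqD:
  assumes "element b \<Sigma> I t = element b \<Sigma> I u"
  shows "cpreds b \<Sigma> I t = cpreds b \<Sigma> I u" "pats b t = pats b u"
proof -
  show "cpreds b \<Sigma> I t = cpreds b \<Sigma> I u"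
    using even_in_element[of _ b \<Sigma> I] assms by (metis subsetI subset_antisym)
  have *: "p \<in> pats b t \<longleftrightarrow> enc_trm p \<le> b \<and> Suc (2 * enc_trm p) \<notin> set_decode (element b \<Sigma> I t)" for p t
    unfolding odd_in_element by (auto simp: pats_def dest: enc_trm_inj)
  show "pats b t = pats b u" by (simp only: set_eq_iff * assms) simp
qed

text \<open>Here the intersection pays off: the operations are well defined on the classes of ground
  terms with the same element.\<close>

lemma element_F_cong:
  assumes "map (element b \<Sigma> I) us = map (element b \<Sigma> I) ts"
  shows "element b \<Sigma> I (F f us) = element b \<Sigma> I (F f ts)"
proof -
  have *: "list_all2 (\<lambda>u t. element b \<Sigma> I u = element b \<Sigma> I t) us ts"
    using assms by (simp add: list_all2_conv_all_nth list_eq_iff_nth_eq)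
  have "cpreds b \<Sigma> I (F f us) = cpreds b \<Sigma> I (F f ts)"
    by (intro cpreds_F_cong list_all2_mono[OF *]) (auto dest: element_eqD)
  moreover have "pats b (F f us) = pats b (F f ts)"
    by (intro pats_F_cong list_all2_mono[OF *]) (auto dest: element_eqD)
  ultimately show ?thesis by (simp add: element_def)
qed

text \<open>Pairing and list coding dominate their components, so the code of the whole input can
  serve as the common bound.\<close>

lemma enc_input_le:
  shows "cc \<in> set N \<Longrightarrow> enc_cclause cc \<le> enc_input (\<Sigma>, N)"
    and "(f, n) \<in> set \<Sigma> \<Longrightarrow> f \<le> enc_input (\<Sigma>, N)"
    and "(f, n) \<in> set \<Sigma> \<Longrightarrow> n \<le> enc_input (\<Sigma>, N)"
proof -
  let ?s = "list_encode (map prod_encode \<Sigma>)" and ?n = "list_encode (map enc_cclause N)"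
  have x: "enc_input (\<Sigma>, N) = prod_encode (?s, ?n)" by (simp add: enc_input_def)
  show "enc_cclause cc \<le> enc_input (\<Sigma>, N)" if "cc \<in> set N"
    using less_list_encode[of "enc_cclause cc" "map enc_cclause N"] le_prod_encode_2[of ?n ?s] that
    unfolding x by auto
  have "prod_encode (f, n) \<le> enc_input (\<Sigma>, N)" if "(f, n) \<in> set \<Sigma>"
    using less_list_encode[of "prod_encode (f, n)" "map prod_encode \<Sigma>"] le_prod_encode_1[of ?s ?n]
      image_eqI[OF refl that, of prod_encode]
    unfolding x by auto
  then show "f \<le> enc_input (\<Sigma>, N)" "n \<le> enc_input (\<Sigma>, N)" if "(f, n) \<in> set \<Sigma>"
    using that le_prod_encode_1[of f n] le_prod_encode_2[of n f] by auto
qed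

lemma list_encode_less_args_bound:
  assumes "\<forall>d\<in>set ds. d < element_bound x" "length ds \<le> x"
  shows "list_encode ds < args_bound x"
proof -
  have "\<forall>d\<in>set ds. d \<le> element_bound x" using assms(1) by (simp add: less_imp_le)
  from list_encode_le_list_bound[OF this assms(2)] show ?thesis
    by (simp add: args_bound_def less_Suc_eq_le)
qed

lemma decode_input:
  "list_decode (pfst (enc_input (\<Sigma>, N))) = map prod_encode \<Sigma>"
  "list_decode (psnd (enc_input (\<Sigma>, N))) = map enc_cclause N"
  by (simp_all add: enc_input_def pfst_def psnd_def)

lemma decode_cclause:
  "list_decode (pfst (pfst (enc_cclause ((\<Gamma>, \<Delta>), \<pi>)))) = map enc_atom \<Gamma>"
  "list_decode (psnd (pfst (enc_cclause ((\<Gamma>, \<Delta>), \<pi>)))) = map enc_atom \<Delta>"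
  "list_decode (psnd (enc_cclause ((\<Gamma>, \<Delta>), \<pi>))) = map (\<lambda>(t, s). prod_encode (enc_trm t, enc_trm s)) \<pi>"
  by (simp_all add: enc_cclause_def pfst_def psnd_def)

lemma enc_simps:
  "pfst (enc_trm (V y)) = 0"
  "pfst (enc_trm (F f ts)) = 1"
  "pfst (psnd (enc_trm (F f ts))) = f"
  "list_decode (psnd (psnd (enc_trm (F f ts)))) = map enc_trm ts"
  "pfst (enc_atom (P p t)) = 0"
  "pfst (psnd (enc_atom (P p t))) = p"
  "psnd (psnd (enc_atom (P p t))) = enc_trm t"
  "pfst (enc_atom (Eq s t)) = 1"
  by (simp_all add: pfst_def psnd_def)

text \<open>The certificate is the quotient of the Herbrand universe by \<open>element\<close>. From
  a table falsifying a clause, a ground instance false in the canonical interpretation is read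
  off.\<close>

lemma satisfiable_imp_certifiable:
  assumes N: "msl_sdc_input (\<Sigma>, N)" and "satisfiable \<Sigma> N"
  shows "certifiable (enc_input (\<Sigma>, N))"
proof -
  obtain I where I: "\<And>cc. cc \<in> set N \<Longrightarrow> sat_cclause \<Sigma> I cc"
    using assms(2) unfolding satisfiable_def by blast
  define x where "x = enc_input (\<Sigma>, N)"
  define M where "M = element_bound x"
  define D where "D = args_bound x"
  define h where "h = element x \<Sigma> I"
  define G where "G = {t. ground_term \<Sigma> t}"
  define U where "U = h ` G"
  define W where "W = {pr f (pr (list_encode (map h ts)) (h (F f ts))) | f ts. F f ts \<in> G}"
  have h_less: "h t < M" for t unfolding h_def M_def element_bound_def by (rule element_less)
  have args_less: "list_encode (map h ts) < D" if "(f, length ts) \<in> set \<Sigma>" for f ts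
    unfolding D_def using enc_input_le(3)[OF that, of N] h_less
    by (intro list_encode_less_args_bound) (auto simp: x_def[symmetric] M_def[symmetric])
  have U: "U \<subseteq> {..<M}" unfolding U_def using h_less by blast
  have W: "W \<subseteq> {..<pr (Suc x) (pr D M)}"
  proof
    fix k assume "k \<in> W"
    then obtain f ts where k: "k = pr f (pr (list_encode (map h ts)) (h (F f ts)))"
      and f: "(f, length ts) \<in> set \<Sigma>"
      by (auto simp: W_def G_def ground_term_F)
    have "f < Suc x" using enc_input_le(2)[OF f, of N] x_def by simp
    moreover have "pr (list_encode (map h ts)) (h (F f ts)) \<le> pr D M"
      using args_less[OF f] h_less by (intro pr_mono less_imp_le)
    ultimately show "k \<in> {..<pr (Suc x) (pr D M)}" unfolding k by (simp add: pr_strict_mono)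
  qed
  have "closed_algebra (Suc x) M D (pfst x) U W"
    unfolding closed_algebra_def
  proof (intro ballI allI impI, elim conjE)
    fix s l
    assume s: "s \<in> set (list_decode (pfst x))" and l: "l < D" "length (list_decode l) = psnd s"
      "\<forall>d\<in>set (list_decode l). d \<in> U"
    from s have "s \<in> prod_encode ` set \<Sigma>" by (simp add: x_def decode_input)
    then have "(pfst s, psnd s) \<in> set \<Sigma>" by (auto simp: pfst_def psnd_def)
    define ts where "ts = map (inv_into G h) (list_decode l)"
    have ts: "map h ts = list_decode l" unfolding ts_def map_map comp_def
      by (rule map_idI, rule f_inv_into_f) (use l(3) in \<open>simp add: U_def\<close>)
    have "set ts \<subseteq> G" using l(3) by (auto simp: ts_def U_def inv_into_into)
    moreover have "length ts = psnd s" using l(2) by (simp add: ts_def)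
    ultimately have G: "F (pfst s) ts \<in> G"
      using \<open>(pfst s, psnd s) \<in> set \<Sigma>\<close> by (auto simp: G_def ground_term_F)
    let ?d = "h (F (pfst s) ts)"
    have "pr (pfst s) (pr l ?d) \<in> W"
      unfolding W_def using G by (intro CollectI exI conjI) (simp_all add: ts)
    moreover have "pfst p = 0 \<or> (pfst p = 1 \<and> pfst (psnd p) = pfst s \<and>
        list_all2 (\<lambda>q e. Suc (2 * q) \<notin> set_decode e)
          (list_decode (psnd (psnd p))) (list_decode l))"
      if p: "p < Suc x" "Suc (2 * p) \<notin> set_decode ?d" for p
    proof -
      have "p \<in> enc_trm ` pats x (F (pfst s) ts)" using p unfolding h_def odd_in_element by simp
      then obtain q where q: "p = enc_trm q" "lmatch (F (pfst s) ts) q" unfolding pats_def by blast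
      show ?thesis
      proof (cases q)
        case (V y) then show ?thesis using q by (simp only: enc_simps) simp
      next
        case (F g qs)
        have "list_all2 (\<lambda>q e. Suc (2 * q) \<notin> set_decode e) (map enc_trm qs) (map h ts)"
          unfolding list_all2_map1 list_all2_map2
        proof (rule list_all2_all_nthI)
          show "length qs = length ts" using q(2) F by (auto dest: list_all2_lengthD)
          fix i assume i: "i < length qs"
          then have "enc_trm (qs ! i) \<le> x"
            using enc_trm_arg_less[of "qs ! i" qs g] p(1) q(1) F by (simp del: enc_trm.simps)
          moreover have "lmatch (ts ! i) (qs ! i)"
            using q(2) F i by (auto simp: list_all2_conv_all_nth)
          ultimately show "Suc (2 * enc_trm (qs ! i)) \<notin> set_decode (h (ts ! i))"
            unfolding h_def odd_in_element pats_def by simp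
        qed
        with q F ts show ?thesis by (simp add: enc_simps del: enc_trm.simps)
      qed
    qed
    moreover have "?d \<in> U" using G unfolding U_def by blast
    ultimately show "\<exists>d<M. d \<in> U \<and> pr (pfst s) (pr l d) \<in> W \<and>
        (\<forall>p<Suc x. Suc (2 * p) \<notin> set_decode d \<longrightarrow>
           pfst p = 0 \<or> (pfst p = 1 \<and> pfst (psnd p) = pfst s \<and>
             list_all2 (\<lambda>q e. Suc (2 * q) \<notin> set_decode e)
               (list_decode (psnd (psnd p))) (list_decode l)))"
      using h_less by blast
  qed
  moreover have "\<not> (consistent (Suc x) M D U W v \<and> falsified M v c)"
    if c: "c \<in> set (list_decode (psnd x))" for c v
  proof (rule notI, elim conjE)
    assume con: "consistent (Suc x) M D U W v" and fal: "falsified M v c"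
    from c obtain cc where cc: "cc \<in> set N" "c = enc_cclause cc"
      by (auto simp: x_def decode_input)
    obtain \<Gamma> \<Delta> \<pi> where C: "cc = ((\<Gamma>, \<Delta>), \<pi>)" by (metis surj_pair)
    have c_le: "c \<le> x" using enc_input_le(1)[OF cc(1)] cc(2) x_def by simp
    have msl: "msl_sdc_clause \<Sigma> cc" using N cc(1) by (simp add: msl_sdc_input_def)
    \<comment> \<open>A variable is sent to a ground term representing its value in the
      table.\<close>
    define \<delta> where "\<delta> y = (SOME t. t \<in> G \<and> pr (enc_trm (V y)) (h t) \<in> v)" for y
    \<comment> \<open>By consistency an entry for a compound term forces entries for its arguments,
      so induction applies and also shows that all variables involved have values.\<close>
    have eval: "(\<forall>y\<in>vars t. \<delta> y \<in> G) \<and> d = h (subst t \<delta>)"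
      if "enc_trm t \<le> x" "d < M" "pr (enc_trm t) d \<in> v" for t d
      using that
    proof (induction t arbitrary: d)
      case (V y)
      then have "d \<in> U" and uniq: "\<And>e. e < M \<Longrightarrow> pr (enc_trm (V y)) e \<in> v \<Longrightarrow> d = e"
        using con enc_simps(1)[of y] unfolding consistent_def by (metis le_imp_less_Suc)+
      then obtain t where "t \<in> G" "h t = d" unfolding U_def by blast
      with V.prems(3) have "\<delta> y \<in> G \<and> pr (enc_trm (V y)) (h (\<delta> y)) \<in> v"
        unfolding \<delta>_def by (intro someI[of "\<lambda>t. t \<in> G \<and> pr (enc_trm (V y)) (h t) \<in> v" t]) simp
      with uniq[OF h_less] show ?case by simp
    next
      case (F f ts)
      from F.prems con obtain l
        where l: "list_all2 (\<lambda>b e. pr b e \<in> v) (map enc_trm ts) (list_decode l)"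
          "pr f (pr l d) \<in> W"
        unfolding consistent_def using enc_simps(2-4)[of f ts] by (metis le_imp_less_Suc)
      \<comment> \<open>The entry of \<open>W\<close> stems from some arguments \<open>us\<close>,
        not necessarily from instances of \<open>ts\<close>; they agree up to \<open>h\<close>,
        which is enough by congruence.\<close>
      from l(2) obtain g us where "pr f (pr l d) = pr g (pr (list_encode (map h us)) (h (F g us)))"
        unfolding W_def by blast
      then have us: "list_decode l = map h us" "d = h (F f us)"
        by (metis pfst_pr psnd_pr list_encode_inverse)+
      have len: "length us = length ts" using l(1) us(1) by (auto dest: list_all2_lengthD)
      have IH: "(\<forall>y\<in>vars (ts ! i). \<delta> y \<in> G) \<and> h (us ! i) = h (subst (ts ! i) \<delta>)"
        if i: "i < length ts" for i
      proof (rule F.IH)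
        show "ts ! i \<in> set ts" using i by simp
        show "enc_trm (ts ! i) \<le> x" using enc_trm_arg_less[of "ts ! i" ts f] i F.prems(1)
          by (metis le_trans less_imp_le_nat nth_mem)
        show "pr (enc_trm (ts ! i)) (h (us ! i)) \<in> v"
          using l(1) us(1) i len by (auto simp: list_all2_conv_all_nth)
      qed (rule h_less)
      then have "map h us = map h (map (\<lambda>t. subst t \<delta>) ts)"
        using len by (simp add: list_eq_iff_nth_eq)
      then have "d = h (subst (F f ts) \<delta>)"
        using us(2) element_F_cong unfolding h_def by simp
      moreover have "\<forall>y\<in>vars (F f ts). \<delta> y \<in> G"
        using IH by (auto simp: in_set_conv_nth)
      ultimately show ?case by blast
    qed
    have fal_\<Gamma>: "\<And>A. A \<in> set \<Gamma> \<Longrightarrow> pfst (enc_atom A) = 0 \<and>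
        (\<exists>d<M. pr (psnd (psnd (enc_atom A))) d \<in> v \<and> 2 * pfst (psnd (enc_atom A)) \<in> set_decode d)"
      and fal_\<Delta>: "\<And>A. A \<in> set \<Delta> \<Longrightarrow>
        \<exists>d<M. pr (psnd (psnd (enc_atom A))) d \<in> v \<and> 2 * pfst (psnd (enc_atom A)) \<notin> set_decode d"
      and fal_\<pi>: "\<And>t s. (t, s) \<in> set \<pi> \<Longrightarrow>
        \<exists>d<M. pr (enc_trm t) d \<in> v \<and> Suc (2 * enc_trm s) \<in> set_decode d"
      using fal unfolding falsified_def cc(2) C decode_cclause
      by (fastforce simp: pfst_def psnd_def)+
    have \<Gamma>: "\<exists>p t. A = P p t \<and> (\<forall>y\<in>vars t. \<delta> y \<in> G) \<and> p \<in> cpreds x \<Sigma> I (subst t \<delta>)"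
      if A: "A \<in> set \<Gamma>" for A
    proof -
      obtain p t where pt: "A = P p t"
        using fal_\<Gamma>[OF A] enc_simps(8) by (cases A) auto
      from fal_\<Gamma>[OF A] obtain d where d: "d < M" "pr (enc_trm t) d \<in> v" "2 * p \<in> set_decode d"
        unfolding pt enc_simps by blast
      have "enc_trm t \<le> x"
        using enc_cclause_atom_le[of A \<Gamma> \<Delta> \<pi>] A pt c_le enc_atom_bounds(2)[of t p] cc(2) C by simp
      from eval[OF this d(1,2)] d(3) pt show ?thesis by (simp add: h_def even_in_element)
    qed
    have \<Delta>: "\<exists>p t. A = P p t \<and> (\<forall>y\<in>vars t. \<delta> y \<in> G) \<and> p \<notin> cpreds x \<Sigma> I (subst t \<delta>)"
      if A: "A \<in> set \<Delta>" for A
    proof -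
      from msl A obtain p t where pt: "A = P p t"
        by (fastforce simp: C msl_sdc_clause_def msl_clause_def)
      from fal_\<Delta>[OF A] obtain d where d: "d < M" "pr (enc_trm t) d \<in> v" "2 * p \<notin> set_decode d"
        unfolding pt enc_simps by blast
      have "enc_trm t \<le> x"
        using enc_cclause_atom_le[of A \<Gamma> \<Delta> \<pi>] A pt c_le enc_atom_bounds(2)[of t p] cc(2) C by simp
      from eval[OF this d(1,2)] d(3) pt show ?thesis by (simp add: h_def even_in_element)
    qed
    have \<pi>: "(\<forall>y\<in>vars t. \<delta> y \<in> G) \<and> \<not> lmatch (subst t \<delta>) s" if ts: "(t, s) \<in> set \<pi>" for t s
    proof -
      from fal_\<pi>[OF ts] obtain d
        where d: "d < M" "pr (enc_trm t) d \<in> v" "Suc (2 * enc_trm s) \<in> set_decode d" by blast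
      have "enc_trm t \<le> x" "enc_trm s \<le> x"
        using enc_cclause_sdc_le[OF ts, of \<Gamma> \<Delta>] c_le cc(2) C by simp_all
      with eval[OF this(1) d(1,2)] d(3) show ?thesis
        by (auto simp: h_def odd_in_element pats_def simp del: set_decode_Suc)
    qed
    have "ground_instance_subst \<Sigma> cc \<delta>"
      unfolding ground_instance_subst_def sdc_solution_def
    proof (intro conjI ballI)
      fix y assume "y \<in> cclause_vars cc"
      then show "ground_term \<Sigma> (\<delta> y)"
        using \<Gamma> \<Delta> \<pi> by (fastforce simp: C cclause_vars_def G_def)
    next
      fix q assume "q \<in> set (snd cc)"
      moreover obtain t s where q: "q = (t, s)" by fastforce
      ultimately have "\<not> lmatch (subst t \<delta>) s" using \<pi>[of t s] by (simp add: C)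
      then have "subst s \<sigma> \<noteq> subst t \<delta>" for \<sigma> using instance_imp_lmatch[of s \<sigma>] by auto
      then show "case q of (t, s) \<Rightarrow> \<not> instance_of (subst t \<delta>) s"
        by (simp add: q instance_of_def)
    qed
    moreover have "\<not> sat_ground (canonical x \<Sigma> I) (clause_subst (fst cc) \<delta>)"
      unfolding sat_ground_def clause_subst_def C using \<Gamma> \<Delta> by fastforce
    ultimately show False
      using sat_canonical[OF I[OF cc(1)] msl, of x] c_le cc(2) unfolding sat_cclause_def by blast
  qed
  moreover have "set_decode (set_encode U) = U" "set_decode (set_encode W) = W"
    using U W finite_subset by (auto intro!: set_encode_inverse)
  ultimately show ?thesis
    unfolding certifiable_def x_def[symmetric] M_def[symmetric] D_def[symmetric]
    using set_encode_less[OF U] set_encode_less[OF W] by metis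
qed

section \<open>From a finite algebra to a model\<close>

text \<open>The value 0 of a variable is a placeholder; the properties below concern ground
  terms.\<close>

fun term_value :: "(nat \<Rightarrow> nat list \<Rightarrow> nat) \<Rightarrow> trm \<Rightarrow> nat" where
  "term_value \<alpha> (V y) = 0"
| "term_value \<alpha> (F f ts) = \<alpha> f (map (term_value \<alpha>) ts)"

lemma ground_subst:
  assumes "wf_term \<Sigma> t" "\<And>y. y \<in> vars t \<Longrightarrow> ground_term \<Sigma> (\<delta> y)"
  shows "ground_term \<Sigma> (subst t \<delta>)"
  using assms
proof (induction t)
  case (F f ts)
  then show ?case by (auto simp: ground_term_F list_all_iff)
qed simp

text \<open>Ground terms are evaluated in the algebra, and the predicates true of a term are read
  off its value. A falsified ground instance would give a consistent table of values that falsifies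
  the clause.\<close>

lemma certifiable_imp_satisfiable:
  assumes N: "msl_sdc_input (\<Sigma>, N)" and "certifiable (enc_input (\<Sigma>, N))"
  shows "satisfiable \<Sigma> N"
proof -
  define x where "x = enc_input (\<Sigma>, N)"
  define M where "M = element_bound x"
  define D where "D = args_bound x"
  from assms(2) obtain U W where alg: "closed_algebra (Suc x) M D (pfst x) U W"
    and cert: "\<And>c v. c \<in> set (list_decode (psnd x)) \<Longrightarrow> v < 2 ^ pr (Suc x) M \<Longrightarrow>
      \<not> (consistent (Suc x) M D U W (set_decode v) \<and> falsified M (set_decode v) c)"
    unfolding certifiable_def x_def[symmetric] M_def[symmetric] D_def[symmetric] by blast
  \<comment> \<open>These are the results promised by \<open>closed_algebra\<close>. Any choice
    among them will do, because consistency of a table only asks for membership in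
    \<open>W\<close>.\<close>
  define ok where "ok f ds d \<longleftrightarrow> d < M \<and> d \<in> U \<and> pr f (pr (list_encode ds) d) \<in> W \<and>
    (\<forall>p<Suc x. Suc (2 * p) \<notin> set_decode d \<longrightarrow> pfst p = 0 \<or> (pfst p = 1 \<and> pfst (psnd p) = f \<and>
       list_all2 (\<lambda>q e. Suc (2 * q) \<notin> set_decode e) (list_decode (psnd (psnd p))) ds))" for f ds d
  define h where "h = term_value (\<lambda>f ds. SOME d. ok f ds d)"
  have args_less: "list_encode ds < D"
    if "(f, length ds) \<in> set \<Sigma>" "\<forall>d\<in>set ds. d < M" for f ds
    unfolding D_def using enc_input_le(3)[OF that(1), of N] that(2)
    by (intro list_encode_less_args_bound) (auto simp: x_def[symmetric] M_def[symmetric])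
  have ex_ok: "\<exists>d. ok f ds d"
    if "(f, length ds) \<in> set \<Sigma>" "\<forall>d\<in>set ds. d < M \<and> d \<in> U" for f ds
  proof -
    have "prod_encode (f, length ds) \<in> set (list_decode (pfst x))"
      using that(1) by (auto simp: x_def decode_input)
    moreover have "list_encode ds < D" using args_less that by blast
    ultimately have "\<exists>d<M. ok f ds d"
      using alg[unfolded closed_algebra_def, rule_format, of "prod_encode (f, length ds)" "list_encode ds"]
        that(2) unfolding ok_def by (auto simp: pfst_def psnd_def)
    then show ?thesis by blast
  qed
  have ok_if: "ok f (map h ts) (h (F f ts))"
    if "(f, length ts) \<in> set \<Sigma>" "\<forall>t\<in>set ts. h t < M \<and> h t \<in> U" for f ts
    using someI_ex[OF ex_ok[of f "map h ts"]] that by (simp add: h_def)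
  have h_U: "h t < M \<and> h t \<in> U" if "ground_term \<Sigma> t" for t
    using that
  proof (induction t)
    case (F f ts)
    then have "ok f (map h ts) (h (F f ts))" by (intro ok_if) (auto simp: ground_term_F)
    then show ?case unfolding ok_def by blast
  qed (simp add: ground_term_def)
  have ok: "ok f (map h ts) (h (F f ts))" if "ground_term \<Sigma> (F f ts)" for f ts
    using that h_U by (intro ok_if) (auto simp: ground_term_F)
  \<comment> \<open>This direction suffices: its contrapositive sets the bit of every pattern that
    is not matched, as needed for the disequations.\<close>
  have lmatch: "lmatch t s"
    if "ground_term \<Sigma> t" "enc_trm s \<le> x" "Suc (2 * enc_trm s) \<notin> set_decode (h t)" for t s
    using that
  proof (induction t arbitrary: s)
    case (F f ts)
    show ?case
    proof (cases s)
      case s: (F g qs)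
      from ok[OF F.prems(1)] F.prems(2,3)
      have "pfst (enc_trm s) = 0 \<or> (pfst (enc_trm s) = 1 \<and> pfst (psnd (enc_trm s)) = f \<and>
          list_all2 (\<lambda>q e. Suc (2 * q) \<notin> set_decode e)
            (list_decode (psnd (psnd (enc_trm s)))) (map h ts))"
        unfolding ok_def by (meson le_imp_less_Suc)
      then have g: "g = f" and
        args: "list_all2 (\<lambda>q t. Suc (2 * enc_trm q) \<notin> set_decode (h t)) qs ts"
        unfolding s enc_simps list_all2_map1 list_all2_map2 by simp_all
      have "lmatch (ts ! i) (qs ! i)" if i: "i < length ts" for i
      proof (rule F.IH)
        show "ts ! i \<in> set ts" using i by simp
        then show "ground_term \<Sigma> (ts ! i)" using F.prems(1) by (simp add: ground_term_F)
        have "qs ! i \<in> set qs" using i list_all2_lengthD[OF args] by simp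
        from enc_trm_arg_less[OF this, of g] show "enc_trm (qs ! i) \<le> x"
          using F.prems(2)[unfolded s] by (rule less_imp_le[OF less_le_trans])
        show "Suc (2 * enc_trm (qs ! i)) \<notin> set_decode (h (ts ! i))"
          using list_all2_nthD2[OF args i] .
      qed
      with list_all2_lengthD[OF args] g s show ?thesis by (simp add: list_all2_conv_all_nth)
    qed simp
  qed (simp add: ground_term_def)
  define I where "I = {P p t | p t. 2 * p \<in> set_decode (h t)}"
  have "sat_cclause \<Sigma> I cc" if cc: "cc \<in> set N" for cc
  proof (rule ccontr)
    obtain \<Gamma> \<Delta> \<pi> where C: "cc = ((\<Gamma>, \<Delta>), \<pi>)" by (metis surj_pair)
    assume "\<not> ?thesis"
    then obtain \<delta> where gr: "\<forall>y\<in>cclause_vars cc. ground_term \<Sigma> (\<delta> y)"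
      and sol: "sdc_solution \<pi> \<delta>"
      and neg: "\<not> sat_ground I (clause_subst (\<Gamma>, \<Delta>) \<delta>)"
      unfolding sat_cclause_def ground_instance_subst_def C by auto
    from neg have \<Gamma>: "\<And>A. A \<in> set \<Gamma> \<Longrightarrow> atom_subst A \<delta> \<in> I"
      and \<Delta>: "\<And>A. A \<in> set \<Delta> \<Longrightarrow> atom_subst A \<delta> \<notin> I"
      unfolding sat_ground_def clause_subst_def by auto
    have msl: "msl_sdc_clause \<Sigma> cc" using N cc by (simp add: msl_sdc_input_def)
    then have wf: "\<And>A. A \<in> set \<Gamma> \<union> set \<Delta> \<Longrightarrow> wf_atom \<Sigma> A"
      and wf_sdc: "\<And>t s. (t, s) \<in> set \<pi> \<Longrightarrow> wf_term \<Sigma> t"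
      and str: "\<And>t s. (t, s) \<in> set \<pi> \<Longrightarrow> straight s"
      and pred: "\<And>A. A \<in> set \<Delta> \<Longrightarrow> \<exists>p t. A = P p t"
      by (auto simp: C msl_sdc_clause_def msl_clause_def wf_cclause_def list_all_iff is_sdc_def)
    have c_le: "enc_cclause cc \<le> x" using enc_input_le(1)[OF cc] x_def by simp
    \<comment> \<open>The set contains the terms of the clause relevant to falsification and is
      closed under subterms, because arguments have smaller codes; consistency demands entries for
      them.\<close>
    define T where "T = {t. enc_trm t \<le> x \<and> wf_term \<Sigma> t \<and> vars t \<subseteq> cclause_vars cc}"
    define v where "v = (\<lambda>t. pr (enc_trm t) (h (subst t \<delta>))) ` T"
    have ground: "ground_term \<Sigma> (subst t \<delta>)" if "t \<in> T" for t
      using that gr by (intro ground_subst) (auto simp: T_def)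
    have v: "v \<subseteq> {..<pr (Suc x) M}"
    proof -
      have "pr (enc_trm t) (h (subst t \<delta>)) < pr (Suc x) M" if "t \<in> T" for t
        using h_U[OF ground[OF that]] that by (intro pr_strict_mono) (simp_all add: T_def)
      then show ?thesis unfolding v_def by blast
    qed
    have v_cases: "\<exists>t\<in>T. c = enc_trm t \<and> d = h (subst t \<delta>)" if "pr c d \<in> v" for c d
      using that unfolding v_def pr_eq_iff image_iff .
    have "consistent (Suc x) M D U W v"
      unfolding consistent_def
    proof (intro allI impI conjI)
      fix c d e assume "pr c d \<in> v" "pr c e \<in> v"
      then show "d = e" using v_cases[of c d] v_cases[of c e] enc_trm_inj by blast
    next
      fix c d assume "pr c d \<in> v"
      then obtain t where "t \<in> T" "d = h (subst t \<delta>)" using v_cases by blast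
      then show "d \<in> U" using h_U[OF ground] by simp
    next
      fix c d assume "pr c d \<in> v" "pfst c = 1"
      then obtain t where t: "t \<in> T" "c = enc_trm t" "d = h (subst t \<delta>)"
        using v_cases by blast
      with \<open>pfst c = 1\<close> obtain f ts where F: "t = F f ts" using enc_simps(1) by (cases t) auto
      let ?ds = "map (\<lambda>t. h (subst t \<delta>)) ts"
      have args: "s \<in> T" if "s \<in> set ts" for s
        using t(1) that enc_trm_arg_less[OF that, of f] unfolding F T_def
        by (auto simp: list_all_iff simp del: enc_trm.simps)
      have f: "(f, length ?ds) \<in> set \<Sigma>" using t(1) F by (simp add: T_def)
      have "list_encode ?ds < D"
        using h_U[OF ground[OF args]] by (intro args_less[OF f]) auto
      moreover have "list_all2 (\<lambda>b e. pr b e \<in> v)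
          (list_decode (psnd (psnd c))) (list_decode (list_encode ?ds))"
        using args unfolding t F enc_simps list_encode_inverse list_all2_map1 list_all2_map2
        by (auto simp: v_def intro!: list_all2_refl list.rel_refl_strong)
      moreover have "pr (pfst (psnd c)) (pr (list_encode ?ds) d) \<in> W"
        using ok[of f "map (\<lambda>t. subst t \<delta>) ts"] ground[OF t(1)]
        unfolding t F enc_simps ok_def by (simp add: comp_def)
      ultimately show "\<exists>l<D. list_all2 (\<lambda>b e. pr b e \<in> v) (list_decode (psnd (psnd c))) (list_decode l) \<and>
          pr (pfst (psnd c)) (pr l d) \<in> W"
        by blast
    qed
    moreover have "falsified M v (enc_cclause cc)"
    proof -
      have atom: "h (subst t \<delta>) < M \<and> pr (enc_trm t) (h (subst t \<delta>)) \<in> v"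
        if A: "P p t \<in> set \<Gamma> \<union> set \<Delta>" for p t
      proof -
        have "enc_trm t \<le> x"
          using enc_cclause_atom_le[OF A, of \<pi>] c_le enc_atom_bounds(2)[of t p] C by simp
        moreover have "vars t \<subseteq> cclause_vars cc" using A by (force simp: C cclause_vars_def)
        ultimately have "t \<in> T" using wf[OF A] by (simp add: T_def)
        then show ?thesis using h_U[OF ground] by (simp add: v_def)
      qed
      have "pfst (enc_atom A) = 0 \<and> (\<exists>d<M. pr (psnd (psnd (enc_atom A))) d \<in> v \<and>
          2 * pfst (psnd (enc_atom A)) \<in> set_decode d)" if A: "A \<in> set \<Gamma>" for A
      proof -
        obtain p t where pt: "A = P p t" "2 * p \<in> set_decode (h (subst t \<delta>))"
          using \<Gamma>[OF A] by (cases A) (auto simp: I_def)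
        with A atom[of p t] show ?thesis unfolding pt(1) enc_simps by blast
      qed
      moreover have "\<exists>d<M. pr (psnd (psnd (enc_atom A))) d \<in> v \<and>
          2 * pfst (psnd (enc_atom A)) \<notin> set_decode d" if A: "A \<in> set \<Delta>" for A
      proof -
        obtain p t where pt: "A = P p t" using pred[OF A] by blast
        with \<Delta>[OF A] have "2 * p \<notin> set_decode (h (subst t \<delta>))" by (simp add: I_def)
        with A atom[of p t] show ?thesis unfolding pt enc_simps by blast
      qed
      moreover have "\<exists>d<M. pr (enc_trm t) d \<in> v \<and> Suc (2 * enc_trm s) \<in> set_decode d"
        if ts: "(t, s) \<in> set \<pi>" for t s
      proof -
        have le: "enc_trm t \<le> x" "enc_trm s \<le> x"
          using enc_cclause_sdc_le[OF ts, of \<Gamma> \<Delta>] c_le C by simp_all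
        have "vars t \<subseteq> cclause_vars cc" using ts by (force simp: C cclause_vars_def)
        then have "t \<in> T" using le wf_sdc[OF ts] by (simp add: T_def)
        moreover have "\<not> lmatch (subst t \<delta>) s"
          using sol ts linear_lmatch_imp_instance straight_imp_linear[OF str[OF ts]]
          unfolding sdc_solution_def by blast
        ultimately show ?thesis using lmatch[OF ground le(2)] h_U[OF ground] unfolding v_def by blast
      qed
      ultimately show ?thesis
        unfolding falsified_def C decode_cclause by (auto simp: pfst_def psnd_def)
    qed
    moreover have "set_decode (set_encode v) = v"
      using v finite_subset by (auto intro!: set_encode_inverse)
    moreover have "enc_cclause cc \<in> set (list_decode (psnd x))"
      using cc by (simp add: x_def decode_input)
    ultimately show False using cert set_encode_less[OF v] by metis
  qed
  then show ?thesis unfolding satisfiable_def by blast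
qed

theorem theorem1:
  shows "decidable_on enc_input msl_sdc_input (\<lambda>(\<Sigma>, N). satisfiable \<Sigma> N)"
proof -
  \<comment> \<open>This function decides \<open>certifiable\<close> on every number;
    well-formedness of the input enters through the equivalence with satisfiability.\<close>
  obtain r where r: "\<And>xs. length xs = 1 \<Longrightarrow> eval_recf r xs (of_bool (certifiable (xs ! 0)))"
    using decidable_certifiable unfolding decidable_def computable_def cf_def by blast
  have "eval_recf r [enc_input (\<Sigma>, N)] (if satisfiable \<Sigma> N then 1 else 0)"
    if "msl_sdc_input (\<Sigma>, N)" for \<Sigma> N
  proof -
    have "satisfiable \<Sigma> N \<longleftrightarrow> certifiable (enc_input (\<Sigma>, N))"
      using satisfiable_imp_certifiable certifiable_imp_satisfiable that by blast
    with r[of "[enc_input (\<Sigma>, N)]"] show ?thesis by (simp add: of_bool_def)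
  qed
  then show ?thesis unfolding decidable_on_def by (intro exI[of _ r]) auto
qed

end
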